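(* Let $K$ be a non-empty closed convex subset of $\mathbf{R}^d$ with $K\neq\mathbf{R}^d$, let $\Omega=\mathbf{R}^d\setminus K$, and denote the Hausdorff dimension of the boundary $\Gamma=\partial\Omega$ by $d_H$. Let $c_\Omega=c\circ d_\Gamma$ where $c(s)=s^\delta(1+s)^{\delta'-\delta}$ for $s>0$, with $\delta,\delta'\in[0,2)$, and let $H=-\sum_{k=1}^d\partial_k\,c_\Omega\,\partial_k=-\mathrm{div}(c_\Omega\nabla)$ on $C_c^2(\Omega)$. If $$d-d_H+p\,(\delta\wedge\delta')-2p\;\geq\;2p\,|\delta-\delta'|\,(2-\delta\vee\delta')^{-1}$$ with $p\in(1,\infty)$, then there is a $c_p\in(0,C_p]$, where $C_p=(p-1)\,(d-d_H)\,(d-d_H+p\,(\delta\wedge\delta')-2p)\,p^{-2}$, such that $$\int_\Omega|H\varphi|^p\;\geq\; c_p^{\,p}\int_\Omega|c_\Omega\,d_\Gamma^{\,-2}\varphi|^p$$ for all $\varphi\in C_c^2(\Omega)$. Moreover, if $\delta=\delta'$ then $c_p=C_p$.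
   Context: All functions are real-valued. $d_\Gamma(x)=\inf_{y\in\mathbf{R}^d\setminus\Omega}|x-y|$ for $x\in\Omega$ is the Euclidean distance to the boundary $\Gamma=\partial\Omega$. $\delta\wedge\delta'=\min(\delta,\delta')$ and $\delta\vee\delta'=\max(\delta,\delta')$. Write $\dim(K)$ for the dimension of the affine hull of $K$. The Hausdorff (Minkowski) dimension $d_H$ of $\Gamma$ equals $\dim(K)$ if $\dim(K)\in\{0,\ldots,d-1\}$ and equals $d-1$ if $\dim(K)=d$.
   Formalization: The hypotheses allow C_p = 0 (e.g. d = 3, K a point, δ = δ' = 0, p = 3/2), where (0, C_p] is empty; so c_p is required to lie in [0, C_p], and to be positive whenever C_p > 0. *)

theory Defs
  imports "HOL-Analysis.Analysis"
begin

text \<open>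
  Hausdorff measures and Hausdorff dimension, via countable covers by bounded sets of small
  diameter. The covering sets are required to be bounded because \<^const>\<open>diameter\<close> is only
  meaningful for bounded sets. The dimension ranges over exponents \<open>s > 0\<close>, since
  \<open>0 powr 0 = 0\<close> in HOL; this does not change the infimum.
\<close>

definition hausdorff_pre_measure :: "real \<Rightarrow> real \<Rightarrow> 'a::euclidean_space set \<Rightarrow> ennreal" where
  "hausdorff_pre_measure s \<epsilon> A =
     Inf {(\<Sum>i. ennreal (diameter (U i) powr s)) | U :: nat \<Rightarrow> 'a set.
            A \<subseteq> (\<Union>i. U i) \<and> (\<forall>i. bounded (U i) \<and> diameter (U i) \<le> \<epsilon>)}"

definition hausdorff_measure :: "real \<Rightarrow> 'a::euclidean_space set \<Rightarrow> ennreal" where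
  "hausdorff_measure s A = (SUP \<epsilon>\<in>{0<..}. hausdorff_pre_measure s \<epsilon> A)"

definition hausdorff_dim :: "'a::euclidean_space set \<Rightarrow> real" where
  "hausdorff_dim A = Inf {s. 0 < s \<and> hausdorff_measure s A = 0}"

definition partial :: "'n::finite \<Rightarrow> (real ^ 'n \<Rightarrow> real) \<Rightarrow> real ^ 'n \<Rightarrow> real" where
  "partial k f x = deriv (\<lambda>t. f (x + t *\<^sub>R axis k 1)) 0"

definition C1_on :: "(real ^ 'n::finite) set \<Rightarrow> (real ^ 'n \<Rightarrow> real) \<Rightarrow> bool" where
  "C1_on \<Omega> f \<longleftrightarrow>
     (\<forall>x\<in>\<Omega>. f differentiable (at x)) \<and> (\<forall>k. continuous_on \<Omega> (partial k f))"

definition C2_on :: "(real ^ 'n::finite) set \<Rightarrow> (real ^ 'n \<Rightarrow> real) \<Rightarrow> bool" where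
  "C2_on \<Omega> f \<longleftrightarrow> C1_on \<Omega> f \<and> (\<forall>k. C1_on \<Omega> (partial k f))"

text \<open>
  The elements of \<open>C\<^sub>c\<^sup>2(\<Omega>)\<close> are represented by their extension by zero to the whole space.
\<close>

definition Cc2 :: "(real ^ 'n::finite) set \<Rightarrow> (real ^ 'n \<Rightarrow> real) set" where
  "Cc2 \<Omega> = {\<phi>. C2_on \<Omega> \<phi> \<and> compact (closure {x. \<phi> x \<noteq> 0}) \<and> closure {x. \<phi> x \<noteq> 0} \<subseteq> \<Omega>}"

definition bdry_dist :: "(real ^ 'n::finite) set \<Rightarrow> real ^ 'n \<Rightarrow> real" where
  "bdry_dist \<Omega> x = infdist x (UNIV - \<Omega>)"

definition weight :: "real \<Rightarrow> real \<Rightarrow> real \<Rightarrow> real" where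
  "weight \<delta> \<delta>' s = s powr \<delta> * (1 + s) powr (\<delta>' - \<delta>)"

definition div_form_op :: "(real ^ 'n::finite \<Rightarrow> real) \<Rightarrow> (real ^ 'n \<Rightarrow> real) \<Rightarrow> real ^ 'n \<Rightarrow> real" where
  "div_form_op c \<phi> x = - (\<Sum>k\<in>UNIV. partial k (\<lambda>y. c y * partial k \<phi> y) x)"

end

theory Submission
  imports Defs
begin

text \<open>
  Let \<open>r\<close> be the distance to \<open>K\<close>, let \<open>X x = x - P x\<close> with \<open>P\<close> the nearest-point projection onto \<open>K\<close>,
  and let \<open>k = d - d\<^sub>H\<close>. Then \<open>X = r \<nabla>r\<close> is the gradient of \<open>r\<^sup>2 / 2\<close> and is Lipschitz, although \<open>r\<close>
  need not be twice differentiable.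

  The geometry of \<open>K\<close> enters through one fact, \<open>div X \<ge> k\<close> in the weak sense:
  \<open>- \<integral> X \<bullet> \<nabla>\<zeta> \<ge> k \<integral> \<zeta>\<close> for non-negative \<open>C\<^sup>1\<close> functions \<open>\<zeta>\<close> with compact support in \<open>\<Omega>\<close>
  (\<open>divergence_ge_codimension_of_frontier\<close>). It holds because \<open>X\<close> is monotone, and because along every
  direction orthogonal to \<open>K\<close> it increases at unit rate; when \<open>K\<close> has interior points, convexity of
  \<open>r\<close> itself gives the constant \<open>1\<close>. Monotonicity becomes a statement about weak derivatives by
  moving a difference quotient from \<open>\<zeta>\<close> to \<open>X\<close> (\<open>weak_derivative_ge\<close>). The Hausdorff dimension is
  compared with these constants by \<open>hausdorff_dim_ge\<close>: if the sum of a set and a subspace \<open>W\<close>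
  contains a ball, then the dimension of the set is at least \<open>d - dim W\<close>.

  The analytic part tests \<open>H \<phi>\<close> against \<open>w(r) \<phi> \<bar>\<phi>\<bar>\<^bsup>p-2\<^esup>\<close>, where \<open>w(s) = (c(s) / s\<^sup>2)\<^bsup>p-1\<^esup>\<close> is the weight that
  turns Young's inequality into the Rellich inequality. Put \<open>G(s) = (c(s) / s\<^sup>2)\<^bsup>p\<^esup>\<close>. After one integration by
  parts, completing the square in \<open>r \<nabla>\<phi> + (b / p) \<phi> \<nabla>r\<close> bounds the energy from below by
  \<open>- \<integral> X \<bullet> \<nabla>\<zeta>\<close> with \<open>\<zeta> = m(r) \<bar>\<phi>\<bar>\<^bsup>p\<^esup> / p\<close>, up to terms without derivatives of \<open>\<phi>\<close>, and \<open>div X \<ge> k\<close> applies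
  (\<open>energy_ge\<close>). Here \<open>b = k + p (\<delta> \<and> \<delta>') - 2 p\<close>, and the square is the one that proves the Hardy
  inequality. What is left is a pointwise bound on a function of \<open>r\<close>
  (\<open>weight_coefficient_bound\<close>). The constant is exactly \<open>C\<close> when \<open>\<delta> = \<delta>'\<close>. Otherwise the hypothesis
  absorbs the derivative of the local exponent \<open>s c'(s) / c(s)\<close>, and \<open>(p - 1) b\<^sup>2 / p\<^sup>2\<close> is left.

  For \<open>p < 2\<close> the test function is not \<open>C\<^sup>1\<close>, so \<open>\<phi> \<bar>\<phi>\<bar>\<^bsup>p-2\<^esup>\<close> is replaced by
  \<open>\<phi> (\<phi>\<^sup>2 + \<epsilon>)\<^bsup>(p-2)/2\<^esup>\<close>. The error is bounded by a multiple of \<open>\<epsilon>\<^bsup>p/2\<^esup>\<close>, so \<open>\<epsilon>\<close> tends to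
  \<open>0\<close> outside the integrals.
\<close>

section \<open>Weak derivatives of compactly supported functions\<close>

text \<open>
  Here \<open>g\<close> is the gradient of \<open>f\<close>, and \<open>S\<close> may be any compact set outside which \<open>f\<close> vanishes. Carrying
  \<open>S\<close> along keeps the support fixed under products and compositions.
\<close>

definition C1c :: "'a::euclidean_space set \<Rightarrow> ('a \<Rightarrow> real) \<Rightarrow> ('a \<Rightarrow> 'a) \<Rightarrow> bool" where
  "C1c S f g \<longleftrightarrow> compact S \<and> continuous_on UNIV g \<and> (\<forall>x. (f has_derivative (\<lambda>v. g x \<bullet> v)) (at x)) \<and>
     (\<forall>x. x \<notin> S \<longrightarrow> f x = 0)"

lemma C1cD:
  assumes "C1c S f g"
  shows "compact S" "continuous_on T g" "(f has_derivative (\<lambda>v. g x \<bullet> v)) (at x)"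
    "x \<notin> S \<Longrightarrow> f x = 0" "continuous_on T f"
  using assms unfolding C1c_def
  by (auto intro: continuous_on_subset has_derivative_continuous continuous_at_imp_continuous_on)

lemma C1c_gradient_eq_0:
  assumes "C1c S f g" "x \<notin> S"
  shows "g x = 0"
proof -
  have "closed S" using assms by (simp add: C1c_def compact_imp_closed)
  then have "((\<lambda>x. 0::real) has_derivative (\<lambda>v. g x \<bullet> v)) (at x)"
    using has_derivative_transform_within_open[OF C1cD(3)[OF assms(1), of x], of "- S" "\<lambda>x. 0"]
      assms by (auto simp: C1c_def open_Compl)
  then have "(\<lambda>v. g x \<bullet> v) = (\<lambda>v. 0)"
    by (metis has_derivative_const has_derivative_unique)
  then have "g x \<bullet> g x = 0" by metis
  then show ?thesis by simp
qed

lemma integrable_compact_support: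
  fixes f :: "'a::euclidean_space \<Rightarrow> real"
  assumes "compact S" "continuous_on S f" "\<And>x. x \<notin> S \<Longrightarrow> f x = 0"
  shows "integrable lborel f"
proof -
  have "f = (\<lambda>x. indicator S x *\<^sub>R f x)" using assms(3) by (auto simp: indicator_def fun_eq_iff)
  then show ?thesis using borel_integrable_compact[OF assms(1,2)] by simp
qed

text \<open>
  The factor \<open>u\<close> is controlled on \<open>\<Omega>\<close> alone: off \<open>S\<close> both the product and the proposed gradient
  vanish identically, and \<open>\<Omega>\<close> and the complement of \<open>S\<close> form an open cover of the space. This admits
  factors that are singular on \<open>K\<close>, such as negative powers of the distance.
\<close>

lemma C1c_mult:
  assumes f: "C1c S f g" and "open \<Omega>" "S \<subseteq> \<Omega>"
    and u: "\<And>x. x \<in> \<Omega> \<Longrightarrow> (u has_derivative (\<lambda>v. h x \<bullet> v)) (at x)" and h: "continuous_on \<Omega> h"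
  shows "C1c S (\<lambda>x. u x * f x) (\<lambda>x. u x *\<^sub>R g x + f x *\<^sub>R h x)"
proof -
  have opS: "open (- S)" using f by (simp add: C1c_def compact_imp_closed open_Compl)
  have un: "\<Omega> \<union> - S = UNIV" using assms by auto
  have cu: "continuous_on \<Omega> u"
    using u by (meson continuous_at_imp_continuous_on has_derivative_continuous)
  have "continuous_on (\<Omega> \<union> - S) (\<lambda>x. u x *\<^sub>R g x + f x *\<^sub>R h x)"
  proof (rule continuous_on_open_Un[OF \<open>open \<Omega>\<close> opS])
    show "continuous_on \<Omega> (\<lambda>x. u x *\<^sub>R g x + f x *\<^sub>R h x)"
      by (intro continuous_intros cu h C1cD[OF f])
    show "continuous_on (- S) (\<lambda>x. u x *\<^sub>R g x + f x *\<^sub>R h x)"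
      by (rule continuous_on_eq[of _ "\<lambda>x. 0"])
         (auto simp: C1c_gradient_eq_0[OF f] C1cD(4)[OF f])
  qed
  moreover have "((\<lambda>x. u x * f x) has_derivative (\<lambda>v. (u x *\<^sub>R g x + f x *\<^sub>R h x) \<bullet> v)) (at x)" for x
  proof (cases "x \<in> \<Omega>")
    case True
    show ?thesis
      by (rule has_derivative_eq_rhs[OF has_derivative_mult[OF u[OF True] C1cD(3)[OF f]]])
         (auto simp: inner_add_left)
  next
    case False
    then have x: "x \<in> - S" using assms by auto
    have "((\<lambda>x. u x * f x) has_derivative (\<lambda>v. 0)) (at x)"
      by (rule has_derivative_transform_within_open[OF has_derivative_const[of 0] opS x])
         (auto simp: C1cD(4)[OF f])
    then show ?thesis using x by (simp add: C1c_gradient_eq_0[OF f] C1cD(4)[OF f])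
  qed
  ultimately show ?thesis
    unfolding C1c_def un by (auto simp: C1cD[OF f])
qed

lemma C1c_compose:
  assumes f: "C1c S f g" and F: "\<And>t. (F has_real_derivative F' t) (at t)" "continuous_on UNIV F'" "F 0 = 0"
  shows "C1c S (\<lambda>x. F (f x)) (\<lambda>x. F' (f x) *\<^sub>R g x)"
proof -
  have "((\<lambda>x. F (f x)) has_derivative (\<lambda>v. (F' (f x) *\<^sub>R g x) \<bullet> v)) (at x)" for x
    by (rule has_derivative_eq_rhs[OF has_derivative_compose[OF C1cD(3)[OF f]
          F(1)[unfolded has_field_derivative_def]]]) auto
  then have "\<forall>x. ((\<lambda>x. F (f x)) has_derivative (\<lambda>v. (F' (f x) *\<^sub>R g x) \<bullet> v)) (at x)" by blast
  moreover have "continuous_on UNIV (\<lambda>x. F' (f x) *\<^sub>R g x)"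
    by (intro continuous_intros C1cD[OF f] continuous_on_compose2[OF F(2)]) auto
  ultimately show ?thesis unfolding C1c_def using C1cD(1)[OF f] C1cD(4)[OF f] F(3) by metis
qed

lemma lborel_integral_translate:
  fixes f :: "'a::euclidean_space \<Rightarrow> real"
  assumes "f \<in> borel_measurable borel"
  shows "(\<integral>x. f (c + x) \<partial>lborel) = (\<integral>x. f x \<partial>lborel)"
  using integral_distr[of "(+) c" lborel borel f] assms by (simp add: lborel_distr_plus)

text \<open>
  The difference quotients are bounded by the Lipschitz constant of \<open>f\<close>, and for steps of length at
  most \<open>1\<close> they vanish off the closed unit neighbourhood \<open>S'\<close> of \<open>S\<close>, so dominated convergence
  applies. The factor \<open>Y\<close> may be discontinuous, as the gradient of the distance is on \<open>K\<close>.
\<close>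

lemma difference_quotient_weak_limit:
  fixes f :: "'a::euclidean_space \<Rightarrow> real"
  assumes f: "C1c S f g" and e: "norm e = 1"
    and Y: "Y \<in> borel_measurable borel" and bdd: "\<And>C. compact C \<Longrightarrow> bounded (Y ` C)"
  shows "(\<lambda>n. \<integral>x. Y x * ((f (x - (1 / Suc n) *\<^sub>R e) - f x) / (1 / Suc n)) \<partial>lborel)
           \<longlonglongrightarrow> - (\<integral>x. Y x * (g x \<bullet> e) \<partial>lborel)"
    and "integrable lborel (\<lambda>x. Y x * ((f (x - (1 / Suc n) *\<^sub>R e) - f x) / (1 / Suc n)))"
    and "integrable lborel (\<lambda>x. Y x * (g x \<bullet> e))"
proof -
  define S' where "S' = {x + y |x y. x \<in> S \<and> y \<in> cball 0 1}"
  have S': "compact S'" unfolding S'_def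
    by (rule compact_sums[OF C1cD(1)[OF f] compact_cball])
  have "compact (g ` S)" using C1cD[OF f] by (intro compact_continuous_image) auto
  then obtain M where M: "\<And>x. x \<in> S \<Longrightarrow> norm (g x) \<le> M" "M \<ge> 0"
    using compact_imp_bounded[of "g ` S"] unfolding bounded_pos by fastforce
  have Mg: "norm (g x) \<le> M" for x
    using M C1c_gradient_eq_0[OF f, of x] by (cases "x \<in> S") auto
  obtain N where N: "\<And>x. x \<in> S' \<Longrightarrow> \<bar>Y x\<bar> \<le> N" "N > 0"
    using bdd[OF S'] unfolding bounded_pos by fastforce
  have lip: "\<bar>f x - f y\<bar> \<le> M * norm (x - y)" for x y
  proof -
    have "onorm (\<lambda>v. g z \<bullet> v) \<le> M" for z
      by (rule onorm_bound)
         (use M(2) in \<open>auto intro: order_trans[OF Cauchy_Schwarz_ineq2 mult_right_mono[OF Mg]]\<close>)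
    then have "norm (f x - f y) \<le> M * norm (x - y)"
      using C1cD(3)[OF f] by (intro differentiable_bound[of UNIV f "\<lambda>x v. g x \<bullet> v"]) auto
    then show ?thesis by simp
  qed
  let ?q = "\<lambda>n x. Y x * ((f (x - (1 / Suc n) *\<^sub>R e) - f x) / (1 / Suc n))"
  have bnd: "\<bar>?q n x\<bar> \<le> indicator S' x * (N * M)" for n x
  proof (cases "x \<in> S'")
    case True
    have "\<bar>(f (x - (1 / Suc n) *\<^sub>R e) - f x)\<bar> \<le> M * (1 / Suc n)"
      using lip[of "x - (1 / Suc n) *\<^sub>R e" x] e by simp
    then have "\<bar>(f (x - (1 / Suc n) *\<^sub>R e) - f x)\<bar> / (1 / Suc n) \<le> M"
      by (simp add: field_simps)
    then have "\<bar>Y x\<bar> * (\<bar>(f (x - (1 / Suc n) *\<^sub>R e) - f x)\<bar> / (1 / Suc n)) \<le> N * M"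
      by (intro mult_mono N(1)[OF True]) (use N in auto)
    then show ?thesis using True by (simp add: abs_mult)
  next
    case False
    have "x \<notin> S"
    proof
      assume "x \<in> S"
      then have "x + 0 \<in> S'" unfolding S'_def by (intro CollectI exI[of _ x] exI[of _ 0]) auto
      then show False using False by simp
    qed
    moreover have "x - (1 / Suc n) *\<^sub>R e \<notin> S"
    proof
      assume "x - (1 / Suc n) *\<^sub>R e \<in> S"
      then have "x \<in> S'" unfolding S'_def using e
        by (intro CollectI exI[of _ "x - (1 / Suc n) *\<^sub>R e"] exI[of _ "(1 / Suc n) *\<^sub>R e"]) auto
      then show False using False by simp
    qed
    ultimately show ?thesis using C1cD(4)[OF f] by (simp add: False)
  qed
  have mf: "f \<in> borel_measurable borel" and mg: "g \<in> borel_measurable borel"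
    using C1cD(2,5)[OF f, of UNIV] by (auto intro: borel_measurable_continuous_onI)
  have mq: "?q n \<in> borel_measurable lborel" for n
    using mf Y by measurable
  have intb: "integrable lborel (\<lambda>x. indicator S' x * (N * M))"
    using borel_integrable_compact[OF S', of "\<lambda>x. N * M"] by simp
  show "integrable lborel (?q n)"
    by (rule Bochner_Integration.integrable_bound[OF intb mq]) (use bnd[where n=n] in \<open>auto intro: order_trans[OF _ abs_ge_self]\<close>)
  have lim: "(\<lambda>n. ?q n x) \<longlonglongrightarrow> - (Y x * (g x \<bullet> e))" for x
  proof -
    have "((\<lambda>t. f (x - t *\<^sub>R e)) has_derivative (\<lambda>t. g x \<bullet> (- (t *\<^sub>R e)))) (at 0)"
      by (rule has_derivative_compose[of "\<lambda>t. x - t *\<^sub>R e"])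
         (auto intro!: derivative_eq_intros C1cD(3)[OF f])
    then have "((\<lambda>t. f (x - t *\<^sub>R e)) has_real_derivative - (g x \<bullet> e)) (at 0)"
      unfolding has_field_derivative_def by (rule has_derivative_eq_rhs) auto
    then have "((\<lambda>h. (f (x - h *\<^sub>R e) - f x) / h) \<longlongrightarrow> - (g x \<bullet> e)) (at 0)"
      unfolding DERIV_def by simp
    moreover have "filterlim (\<lambda>n. 1 / real (Suc n)) (at 0) sequentially"
      by (intro filterlim_atI) (use LIMSEQ_inverse_real_of_nat in \<open>auto simp: inverse_eq_divide\<close>)
    ultimately have "(\<lambda>n. (f (x - (1 / Suc n) *\<^sub>R e) - f x) / (1 / Suc n)) \<longlonglongrightarrow> - (g x \<bullet> e)"
      by (rule filterlim_compose)
    from tendsto_mult_left[OF this, of "Y x"] show ?thesis by simp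
  qed
  have mlim: "(\<lambda>x. - (Y x * (g x \<bullet> e))) \<in> borel_measurable lborel" using mg Y by measurable
  have "(\<lambda>n. integral\<^sup>L lborel (?q n)) \<longlonglongrightarrow> (\<integral>x. - (Y x * (g x \<bullet> e)) \<partial>lborel)"
    by (rule integral_dominated_convergence[OF mlim mq intb]) (use bnd lim in auto)
  then show "(\<lambda>n. integral\<^sup>L lborel (?q n)) \<longlonglongrightarrow> - (\<integral>x. Y x * (g x \<bullet> e) \<partial>lborel)" by simp
  have "integrable lborel (\<lambda>x. - (Y x * (g x \<bullet> e)))"
    by (rule integrable_dominated_convergence[where s="?q", OF mlim mq intb]) (use bnd lim in auto)
  then show "integrable lborel (\<lambda>x. Y x * (g x \<bullet> e))" by simp
qed

text \<open>
  Translation invariance makes the integral of every difference quotient zero.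
\<close>

lemma integral_directional_derivative_eq_0:
  fixes f :: "'a::euclidean_space \<Rightarrow> real"
  assumes f: "C1c S f g" and e: "norm e = 1"
  shows "(\<integral>x. g x \<bullet> e \<partial>lborel) = 0"
proof -
  have mf: "f \<in> borel_measurable borel"
    using C1cD(5)[OF f, of UNIV] by (auto intro: borel_measurable_continuous_onI)
  have intf: "integrable lborel f"
    using C1cD[OF f] by (intro integrable_compact_support[of S]) auto
  have tr: "integrable lborel (\<lambda>x. f (x - c))" for c
    using integrable_distr_eq[of "(+) (- c)" lborel borel f] mf intf by (simp add: lborel_distr_plus)
  have "(\<integral>x. 1 * ((f (x - (1 / Suc n) *\<^sub>R e) - f x) / (1 / Suc n)) \<partial>lborel) = 0" for n
    using lborel_integral_translate[OF mf, of "- ((1 / Suc n) *\<^sub>R e)"] tr intf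
    by (simp)
  then show ?thesis
    using difference_quotient_weak_limit(1)[OF f e, of "\<lambda>x. 1"]
    by (simp add: LIMSEQ_const_iff image_constant_conv)
qed

text \<open>
  Translation moves the difference quotient from \<open>f\<close> to \<open>Y\<close>, where the growth condition applies
  pointwise before the step tends to zero.
\<close>

lemma weak_derivative_ge:
  fixes f :: "'a::euclidean_space \<Rightarrow> real"
  assumes f: "C1c S f g" and e: "norm e = 1" and nn: "\<And>x. f x \<ge> 0"
    and Y: "Y \<in> borel_measurable borel" and bdd: "\<And>C. compact C \<Longrightarrow> bounded (Y ` C)"
    and mono: "\<And>x t. t > 0 \<Longrightarrow> Y (x + t *\<^sub>R e) - Y x \<ge> \<kappa> * t"
  shows "- (\<integral>x. Y x * (g x \<bullet> e) \<partial>lborel) \<ge> \<kappa> * (\<integral>x. f x \<partial>lborel)"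
proof (rule LIMSEQ_le_const[OF difference_quotient_weak_limit(1)[OF f e Y bdd]], assumption, intro exI allI impI)
  fix n
  define t where "t = 1 / real (Suc n)"
  have t: "t > 0" by (simp add: t_def)
  have mf: "f \<in> borel_measurable borel"
    using C1cD(5)[OF f, of UNIV] by (auto intro: borel_measurable_continuous_onI)
  have int0: "integrable lborel f"
    using C1cD[OF f] by (intro integrable_compact_support[of S]) auto
  have int1: "integrable lborel (\<lambda>x. Y x * f x)"
  proof -
    obtain N where N: "\<And>x. x \<in> S \<Longrightarrow> \<bar>Y x\<bar> \<le> N" "N > 0"
      using bdd[OF C1cD(1)[OF f]] unfolding bounded_pos by fastforce
    have "\<bar>Y x * f x\<bar> \<le> \<bar>N * f x\<bar>" for x
      using N(1)[of x] C1cD(4)[OF f, of x] N(2) nn[of x]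
      by (cases "x \<in> S") (auto simp: abs_mult mult_right_mono)
    then show ?thesis
      using Bochner_Integration.integrable_bound[of lborel "\<lambda>x. N * f x" "\<lambda>x. Y x * f x"] int0 mf Y by simp
  qed
  note intq = difference_quotient_weak_limit(2)[OF f e Y bdd, of n, folded t_def]
  have "integrable lborel (\<lambda>x. t * (Y x * ((f (x - t *\<^sub>R e) - f x) / t)) + Y x * f x)"
    by (intro Bochner_Integration.integrable_add integrable_mult_right intq int1)
  also have "(\<lambda>x. t * (Y x * ((f (x - t *\<^sub>R e) - f x) / t)) + Y x * f x) = (\<lambda>x. Y x * f (x - t *\<^sub>R e))"
    using t by (simp add: field_simps fun_eq_iff)
  finally have int2: "integrable lborel (\<lambda>x. Y x * f (x - t *\<^sub>R e))" .
  have m2: "(\<lambda>x. Y x * f (x - t *\<^sub>R e)) \<in> borel_measurable borel" using mf Y by measurable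
  have shift: "(\<integral>x. Y (t *\<^sub>R e + x) * f x \<partial>lborel) = (\<integral>x. Y x * f (x - t *\<^sub>R e) \<partial>lborel)"
    using lborel_integral_translate[OF m2, of "t *\<^sub>R e"] by simp
  have int3: "integrable lborel (\<lambda>x. Y (t *\<^sub>R e + x) * f x)"
    using integrable_distr_eq[of "(+) (t *\<^sub>R e)" lborel borel "\<lambda>x. Y x * f (x - t *\<^sub>R e)"] m2 int2
    by (simp add: lborel_distr_plus)
  have "\<kappa> * (\<integral>x. f x \<partial>lborel) = (\<integral>x. \<kappa> * f x \<partial>lborel)" by simp
  also have "\<dots> \<le> (\<integral>x. (Y (t *\<^sub>R e + x) * f x - Y x * f x) / t \<partial>lborel)"
  proof (rule integral_mono)
    show "\<kappa> * f x \<le> (Y (t *\<^sub>R e + x) * f x - Y x * f x) / t" for x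
      using mult_right_mono[OF mono[OF t, of x] nn[of x]] t by (simp add: field_simps)
  qed (use int0 int1 int3 in auto)
  also have "\<dots> = (\<integral>x. Y (t *\<^sub>R e + x) * f x \<partial>lborel) / t - (\<integral>x. Y x * f x \<partial>lborel) / t"
    using int1 int3 by (simp add: diff_divide_distrib)
  also have "\<dots> = (\<integral>x. Y x * ((f (x - t *\<^sub>R e) - f x) / t) \<partial>lborel)"
    unfolding shift using int1 int2 by (simp add: diff_divide_distrib right_diff_distrib)
  finally show "\<kappa> * (\<integral>x. f x \<partial>lborel) \<le> (\<integral>x. Y x * ((f (x - (1 / Suc n) *\<^sub>R e) - f x) / (1 / Suc n)) \<partial>lborel)"
    unfolding t_def .
qed

section \<open>The nearest-point field of a closed convex set\<close>

text \<open>
  Splits the coordinates into those along \<open>W\<close> and those orthogonal to it.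
\<close>

lemma adapted_orthonormal_basis:
  fixes W :: "'a::euclidean_space set"
  assumes W: "subspace W"
  obtains B1 B2 where "B1 \<subseteq> W" "finite B1" "finite B2" "B1 \<inter> B2 = {}" "card B1 = dim W"
    "pairwise orthogonal (B1 \<union> B2)" "\<And>b. b \<in> B1 \<union> B2 \<Longrightarrow> norm b = 1"
    "span (B1 \<union> B2) = UNIV" "card (B1 \<union> B2) = DIM('a)"
proof -
  obtain B1 where B1: "B1 \<subseteq> W" "pairwise orthogonal B1" "\<And>x. x \<in> B1 \<Longrightarrow> norm x = 1"
      "independent B1" "card B1 = dim W" "span B1 = W"
    using orthonormal_basis_subspace[OF W] by metis
  define V where "V = {y. \<forall>x\<in>W. orthogonal x y}"
  have V: "subspace V" unfolding V_def by (rule subspace_orthogonal_to_vectors)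
  obtain B2 where B2: "B2 \<subseteq> V" "pairwise orthogonal B2" "\<And>x. x \<in> B2 \<Longrightarrow> norm x = 1"
      "independent B2" "card B2 = dim V" "span B2 = V"
    using orthonormal_basis_subspace[OF V] by metis
  have fin: "finite B1" "finite B2" using B1 B2 independent_imp_finite by auto
  have disj: "B1 \<inter> B2 = {}"
  proof (rule ccontr)
    assume "B1 \<inter> B2 \<noteq> {}"
    then obtain b where b: "b \<in> B1" "b \<in> W" "b \<in> V" using B1 B2 by auto
    then have "b \<bullet> b = 0" by (auto simp: V_def orthogonal_def)
    then show False using B1(3)[OF b(1)] by simp
  qed
  have orth: "pairwise orthogonal (B1 \<union> B2)"
    unfolding pairwise_def
  proof (intro ballI impI)
    fix x y assume xy: "x \<in> B1 \<union> B2" "y \<in> B1 \<union> B2" "x \<noteq> y"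
    have "orthogonal u v" if "u \<in> B1" "v \<in> B2" for u v
      using that B1(1) B2(1) unfolding V_def by auto
    then show "orthogonal x y"
      using xy B1(2) B2(2) unfolding pairwise_def by (metis Un_iff orthogonal_commute)
  qed
  have sp: "x \<in> span (B1 \<union> B2)" for x
  proof -
    obtain y z where "y \<in> span W" "\<And>w. w \<in> span W \<Longrightarrow> orthogonal z w" "x = y + z"
      using orthogonal_subspace_decomp_exists[of W x] by metis
    moreover have "z \<in> V" unfolding V_def
      using calculation(2) by (auto simp: orthogonal_commute span_base)
    ultimately have "y \<in> span B1" "z \<in> span B2" using B1(6) B2(6) by (auto simp: span_span)
    then have "y \<in> span (B1 \<union> B2)" "z \<in> span (B1 \<union> B2)"
      by (meson span_mono subsetD sup_ge1 sup_ge2)+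
    then show ?thesis unfolding \<open>x = y + z\<close> by (rule span_add)
  qed
  have norm1: "norm b = 1" if "b \<in> B1 \<union> B2" for b using that B1 B2 by auto
  have "independent (B1 \<union> B2)"
    using orth norm1[of 0] by (intro pairwise_orthogonal_independent) auto
  moreover have UNIV: "span (B1 \<union> B2) = UNIV" using sp by blast
  ultimately have "card (B1 \<union> B2) = DIM('a)"
    using dim_span[of "B1 \<union> B2"] by (simp add: dim_eq_card_independent)
  then show ?thesis
    using that[OF B1(1) fin disj B1(5) orth norm1 UNIV] by blast
qed

text \<open>
  This field is half the gradient of the squared distance to \<open>K\<close>.
\<close>

definition nearest_offset :: "'a::euclidean_space set \<Rightarrow> 'a \<Rightarrow> 'a" where
  "nearest_offset K x = x - closest_point K x"

locale closed_convex =
  fixes K :: "'a::euclidean_space set"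
  assumes ne: "K \<noteq> {}" and cl: "closed K" and cv: "convex K"
begin

abbreviation "r \<equiv> \<lambda>x. infdist x K"
abbreviation "X \<equiv> nearest_offset K"
abbreviation "P \<equiv> closest_point K"

lemma open_compl: "open (- K)" using cl by (simp add: open_Compl)

lemma r_pos: "x \<in> - K \<Longrightarrow> r x > 0"
  using infdist_pos_not_in_closed[OF cl ne] by auto

lemma P_in: "P x \<in> K" using closest_point_in_set[OF cl ne] .

lemma norm_X: "norm (X x) = r x"
proof (rule antisym)
  show "norm (X x) \<le> r x"
    unfolding infdist_notempty[OF ne] nearest_offset_def dist_norm[symmetric]
    by (rule cINF_greatest[OF ne]) (rule closest_point_le[OF cl])
  show "r x \<le> norm (X x)"
    unfolding nearest_offset_def dist_norm[symmetric] by (rule infdist_le[OF P_in])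
qed

lemma X_inner_X: "X x \<bullet> X x = (r x)\<^sup>2"
  by (metis norm_X power2_norm_eq_inner)

lemma P_nonexpansive: "norm (P x - P y) \<le> norm (x - y)"
  using closest_point_lipschitz[OF cv cl ne] by (simp add: dist_norm)

lemma continuous_X: "continuous_on T X"
  unfolding nearest_offset_def by (intro continuous_intros continuous_on_closest_point cv cl ne)

lemma continuous_r: "continuous_on T r"
  by (intro continuous_intros)

text \<open>
  Convexity of the distance, in the form obtained from \<open>y - x = (P y - P x) + X y - X x\<close>, the
  variational inequality for \<open>P x\<close>, and the Cauchy-Schwarz inequality for \<open>X x \<bullet> X y\<close>.
\<close>

lemma r_convex_subgradient: "r x * r y \<ge> (r x)\<^sup>2 + X x \<bullet> (y - x)"
proof -
  have 1: "X x \<bullet> (P y - P x) \<le> 0"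
    unfolding nearest_offset_def using closest_point_dot[OF cv cl P_in] .
  have 2: "X x \<bullet> X y \<le> r x * r y"
    using norm_cauchy_schwarz[of "X x" "X y"] by (simp add: norm_X)
  have "y - x = (P y - P x) + X y - X x" by (simp add: nearest_offset_def)
  then have "X x \<bullet> (y - x) = X x \<bullet> (P y - P x) + X x \<bullet> X y - X x \<bullet> X x"
    by (simp add: inner_add_right inner_diff_right)
  then show ?thesis using 1 2 X_inner_X[of x] by linarith
qed

text \<open>
  Testing the distance of \<open>y\<close> with the point \<open>P x\<close>, and that of \<open>x\<close> with \<open>P y\<close>, bounds the remainder
  from both sides; the Lipschitz bound \<open>\<bar>X y - X x\<bar> \<le> 2 \<bar>y - x\<bar>\<close> makes it quadratic.
\<close>

lemma r_sq_expansion: "\<bar>(r y)\<^sup>2 - (r x)\<^sup>2 - 2 * (X x \<bullet> (y - x))\<bar> \<le> 5 * (norm (y - x))\<^sup>2"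
proof -
  have up: "(r v)\<^sup>2 \<le> (r u)\<^sup>2 + 2 * (X u \<bullet> (v - u)) + (norm (v - u))\<^sup>2" for u v
  proof -
    have "r v \<le> norm (v - P u)" using infdist_le[OF P_in, of v u] by (simp add: dist_norm)
    then have "(r v)\<^sup>2 \<le> (norm (v - P u))\<^sup>2" by (simp add: infdist_nonneg power_mono)
    also have "v - P u = X u + (v - u)" by (simp add: nearest_offset_def)
    also have "(norm (X u + (v - u)))\<^sup>2 = (r u)\<^sup>2 + 2 * (X u \<bullet> (v - u)) + (norm (v - u))\<^sup>2"
      by (simp add: power2_norm_eq_inner X_inner_X[symmetric] inner_add_left inner_add_right inner_commute)
    finally show ?thesis .
  qed
  have "\<bar>(X y - X x) \<bullet> (y - x)\<bar> \<le> norm (X y - X x) * norm (y - x)" by (rule Cauchy_Schwarz_ineq2)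
  also have "norm (X y - X x) \<le> 2 * norm (y - x)"
  proof -
    have "X y - X x = (y - x) - (P y - P x)" by (simp add: nearest_offset_def)
    then show ?thesis using norm_triangle_ineq4[of "y - x" "P y - P x"] P_nonexpansive[of y x] by simp
  qed
  finally have "\<bar>(X y - X x) \<bullet> (y - x)\<bar> \<le> 2 * (norm (y - x))\<^sup>2"
    by (simp add: mult_right_mono power2_eq_square)
  moreover have "X y \<bullet> (x - y) = - (X x \<bullet> (y - x)) - (X y - X x) \<bullet> (y - x)"
    by (simp add: algebra_simps inner_diff_left inner_diff_right)
  ultimately show ?thesis using up[of y x] up[of x y] by (simp add: norm_minus_commute)
qed

lemma has_derivative_r_sq: "((\<lambda>x. (r x)\<^sup>2) has_derivative (\<lambda>v. 2 * (X x \<bullet> v))) (at x)"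
proof -
  have "((\<lambda>y. ((r y)\<^sup>2 - (r x)\<^sup>2 - 2 * (X x \<bullet> (y - x))) / norm (y - x)) \<longlongrightarrow> 0) (at x)"
  proof (rule Lim_null_comparison)
    show "\<forall>\<^sub>F y in at x. norm (((r y)\<^sup>2 - (r x)\<^sup>2 - 2 * (X x \<bullet> (y - x))) / norm (y - x)) \<le> 5 * norm (y - x)"
    proof (rule always_eventually, rule allI)
      fix y
      show "norm (((r y)\<^sup>2 - (r x)\<^sup>2 - 2 * (X x \<bullet> (y - x))) / norm (y - x)) \<le> 5 * norm (y - x)"
        using r_sq_expansion[of y x]
        by (cases "y = x") (auto simp: divide_le_eq power2_eq_square)
    qed
    have "((\<lambda>y. 5 * norm (y - x)) \<longlongrightarrow> 5 * norm (x - x)) (at x)" by (intro tendsto_intros)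
    then show "((\<lambda>y. 5 * norm (y - x)) \<longlongrightarrow> 0) (at x)" by simp
  qed
  then have "((\<lambda>y. ((r y)\<^sup>2 - (r x)\<^sup>2 - 2 * (X x \<bullet> (y - x))) /\<^sub>R norm (y - x)) \<longlongrightarrow> 0) (at x)"
    by (simp add: divide_inverse mult.commute)
  then show ?thesis
    unfolding has_derivative_at_within
    by (auto intro!: bounded_linear_intros simp: diff_diff_eq)
qed

text \<open>
  The gradient of \<open>r\<close> off \<open>K\<close>. On \<open>K\<close> the value of the quotient by \<open>0\<close> is \<open>0\<close>, which is a subgradient
  there, so \<open>N\<close> is a monotone field on the whole space.
\<close>

definition N where "N x = X x /\<^sub>R r x"

lemma has_derivative_r: assumes "x \<in> - K" shows "(r has_derivative (\<lambda>v. N x \<bullet> v)) (at x)"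
proof -
  have "((\<lambda>x. sqrt ((r x)\<^sup>2)) has_derivative (\<lambda>v. N x \<bullet> v)) (at x)"
    by (rule has_derivative_eq_rhs[OF has_derivative_real_sqrt[OF _ has_derivative_r_sq]])
       (use r_pos[OF assms] in \<open>auto simp: N_def fun_eq_iff field_simps\<close>)
  then show ?thesis by (simp add: infdist_nonneg)
qed

lemma continuous_N: "continuous_on (- K) N"
  unfolding N_def using r_pos by (intro continuous_intros continuous_X) (metis less_irrefl)

lemma N_inner: "x \<in> - K \<Longrightarrow> X x \<bullet> N x = r x"
  using r_pos[of x] by (simp add: N_def X_inner_X power2_eq_square)

lemma N_subgradient: "r y \<ge> r x + N x \<bullet> (y - x)"
proof (cases "r x = 0")
  case False
  then have "r x > 0" using infdist_nonneg[of x K] by linarith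
  then show ?thesis using r_convex_subgradient[of x y]
    by (simp add: N_def field_simps power2_eq_square)
qed (simp add: N_def infdist_nonneg)

lemma N_monotone: "(N y - N x) \<bullet> (y - x) \<ge> 0"
  using N_subgradient[of x y] N_subgradient[of y x]
  by (simp add: inner_diff_left inner_diff_right)

lemma has_derivative_radial:
  assumes "x \<in> - K" "(u has_real_derivative u' (r x)) (at (r x))"
  shows "((\<lambda>x. u (r x)) has_derivative (\<lambda>v. (u' (r x) *\<^sub>R N x) \<bullet> v)) (at x)"
  by (rule has_derivative_eq_rhs[OF has_derivative_compose[OF has_derivative_r[OF assms(1)]
          assms(2)[unfolded has_field_derivative_def]]]) auto

lemma continuous_radial: "continuous_on {0<..} u \<Longrightarrow> continuous_on (- K) (\<lambda>x. u (r x))"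
  using r_pos by (intro continuous_on_compose2[of "{0<..}" u _ r] continuous_r) auto

lemma C1c_radial_mult:
  assumes f: "C1c S f g" and "S \<subseteq> - K"
    and u: "\<And>s. s > 0 \<Longrightarrow> (u has_real_derivative u' s) (at s)" and u': "continuous_on {0<..} u'"
  shows "C1c S (\<lambda>x. u (r x) * f x) (\<lambda>x. u (r x) *\<^sub>R g x + f x *\<^sub>R (u' (r x) *\<^sub>R N x))"
  by (rule C1c_mult[OF f open_compl assms(2)])
     (intro has_derivative_radial u r_pos continuous_intros continuous_radial u' continuous_N; assumption)+

lemma integrable_X_inner:
  assumes "C1c S f g" shows "integrable lborel (\<lambda>x. X x \<bullet> g x)"
  using C1cD[OF assms] C1c_gradient_eq_0[OF assms]
  by (intro integrable_compact_support[of S] continuous_intros continuous_X) auto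

text \<open>
  In a direction \<open>b\<close> orthogonal to \<open>K\<close> the projection \<open>P\<close> does not move, so the component \<open>X \<bullet> b\<close> grows at
  unit rate. In any other direction it is nondecreasing since \<open>P\<close> is nonexpansive. Summing over an
  orthonormal basis adapted to \<open>W\<close> recovers \<open>X \<bullet> g\<close> and counts the directions in \<open>W\<close>.
\<close>

lemma divergence_ge_codim:
  assumes W: "subspace W" and perp: "\<And>a b w. a \<in> K \<Longrightarrow> b \<in> K \<Longrightarrow> w \<in> W \<Longrightarrow> (a - b) \<bullet> w = 0"
    and f: "C1c S f g" and nn: "\<And>x. f x \<ge> 0"
  shows "- (\<integral>x. X x \<bullet> g x \<partial>lborel) \<ge> real (dim W) * (\<integral>x. f x \<partial>lborel)"
proof -
  obtain B1 B2 where B: "B1 \<subseteq> W" "finite B1" "finite B2" "B1 \<inter> B2 = {}" "card B1 = dim W"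
      and orth: "pairwise orthogonal (B1 \<union> B2)" and norm1: "\<And>b. b \<in> B1 \<union> B2 \<Longrightarrow> norm b = 1"
      and sp: "span (B1 \<union> B2) = UNIV"
    by (rule adapted_orthonormal_basis[OF W]) blast
  have expand: "X x \<bullet> g x = (\<Sum>b\<in>B1 \<union> B2. (X x \<bullet> b) * (g x \<bullet> b))" for x
  proof -
    have "X x = (\<Sum>b\<in>B1 \<union> B2. (X x \<bullet> b) *\<^sub>R b)"
      using orthonormal_basis_expand[OF orth norm1, of "X x"] B(2,3) sp by simp
    then have "X x \<bullet> g x = (\<Sum>b\<in>B1 \<union> B2. (X x \<bullet> b) *\<^sub>R b) \<bullet> g x" by simp
    then show ?thesis by (simp add: inner_sum_right inner_sum_left inner_commute[of _ "g x"])
  qed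
  define \<kappa> :: "'a \<Rightarrow> real" where "\<kappa> b = (if b \<in> B1 then 1 else 0)" for b
  have each: "- (\<integral>x. (X x \<bullet> b) * (g x \<bullet> b) \<partial>lborel) \<ge> \<kappa> b * (\<integral>x. f x \<partial>lborel)"
    if b: "b \<in> B1 \<union> B2" for b
  proof (rule weak_derivative_ge[OF f norm1[OF b] nn])
    show "(\<lambda>x. X x \<bullet> b) \<in> borel_measurable borel"
      by (intro borel_measurable_continuous_onI continuous_intros continuous_X)
    show "bounded ((\<lambda>x. X x \<bullet> b) ` C)" if "compact C" for C
      using that by (intro compact_imp_bounded compact_continuous_image continuous_intros continuous_X)
    fix x and t :: real assume t: "t > 0"
    have bb: "b \<bullet> b = 1" using norm1[OF b] by (simp add: norm_eq_1)
    have eq: "X (x + t *\<^sub>R b) \<bullet> b - X x \<bullet> b = t - (P (x + t *\<^sub>R b) - P x) \<bullet> b"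
      by (simp add: nearest_offset_def inner_diff_left inner_add_left bb)
    show "\<kappa> b * t \<le> X (x + t *\<^sub>R b) \<bullet> b - X x \<bullet> b"
    proof (cases "b \<in> B1")
      case True
      then have "(P (x + t *\<^sub>R b) - P x) \<bullet> b = 0" using perp P_in B(1) by blast
      then show ?thesis using True eq by (simp add: \<kappa>_def)
    next
      case False
      have "(P (x + t *\<^sub>R b) - P x) \<bullet> b \<le> norm (P (x + t *\<^sub>R b) - P x) * norm b"
        by (rule norm_cauchy_schwarz)
      also have "\<dots> \<le> t" using P_nonexpansive[of "x + t *\<^sub>R b" x] norm1[OF b] t by simp
      finally show ?thesis using False eq by (simp add: \<kappa>_def)
    qed
  qed
  have int: "integrable lborel (\<lambda>x. (X x \<bullet> b) * (g x \<bullet> b))" for b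
    using C1cD[OF f] C1c_gradient_eq_0[OF f]
    by (intro integrable_compact_support[of S] continuous_intros continuous_X) auto
  have "- (\<integral>x. X x \<bullet> g x \<partial>lborel) = (\<Sum>b\<in>B1 \<union> B2. - (\<integral>x. (X x \<bullet> b) * (g x \<bullet> b) \<partial>lborel))"
    unfolding expand using int by (simp add: sum_negf)
  also have "\<dots> \<ge> (\<Sum>b\<in>B1 \<union> B2. \<kappa> b * (\<integral>x. f x \<partial>lborel))"
    by (rule sum_mono) (rule each)
  also have "(\<Sum>b\<in>B1 \<union> B2. \<kappa> b * (\<integral>x. f x \<partial>lborel)) = real (dim W) * (\<integral>x. f x \<partial>lborel)"
    unfolding sum_distrib_right[symmetric] \<kappa>_def using B
    by (simp add: sum.If_cases Int_absorb1)
  finally show ?thesis by simp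
qed

text \<open>
  Monotonicity of \<open>X\<close> alone loses the constant, but \<open>N\<close> is monotone too, by convexity of \<open>r\<close>. Testing
  \<open>N\<close> with \<open>r f\<close> instead of \<open>f\<close> gives \<open>N \<bullet> \<nabla>(r f) = X \<bullet> \<nabla>f + f\<close>, and the extra \<open>f\<close> is the gain.
\<close>

lemma divergence_ge_1:
  assumes f: "C1c S f g" and S: "S \<subseteq> - K" and nn: "\<And>x. f x \<ge> 0"
  shows "- (\<integral>x. X x \<bullet> g x \<partial>lborel) \<ge> (\<integral>x. f x \<partial>lborel)"
proof -
  let ?g = "\<lambda>x. r x *\<^sub>R g x + f x *\<^sub>R N x"
  have rf: "C1c S (\<lambda>x. r x * f x) ?g"
    by (rule C1c_mult[OF f open_compl S has_derivative_r continuous_N])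
  have Nb: "norm (N x) \<le> 1" for x
    by (cases "r x = 0") (auto simp: N_def norm_X infdist_nonneg)
  have mX: "X \<in> borel_measurable borel" and mr: "r \<in> borel_measurable borel"
    by (auto intro!: borel_measurable_continuous_onI continuous_X continuous_r)
  have mN: "N \<in> borel_measurable borel"
    unfolding N_def[abs_def] using mX mr by measurable
  have zero: "- (\<integral>x. (N x \<bullet> b) * (?g x \<bullet> b) \<partial>lborel) \<ge> 0 * (\<integral>x. r x * f x \<partial>lborel)"
    and int: "integrable lborel (\<lambda>x. (N x \<bullet> b) * (?g x \<bullet> b))" if b: "b \<in> Basis" for b :: 'a
  proof -
    have mNb: "(\<lambda>x. N x \<bullet> b) \<in> borel_measurable borel" using mN by measurable
    have bdd: "bounded ((\<lambda>x. N x \<bullet> b) ` C)" for C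
      unfolding bounded_iff using order_trans[OF Basis_le_norm[OF b] Nb] by auto
    show "- (\<integral>x. (N x \<bullet> b) * (?g x \<bullet> b) \<partial>lborel) \<ge> 0 * (\<integral>x. r x * f x \<partial>lborel)"
    proof (rule weak_derivative_ge[OF rf _ _ mNb bdd])
      fix x and t :: real assume t: "t > 0"
      have "0 \<le> t * ((N (x + t *\<^sub>R b) - N x) \<bullet> b)"
        using N_monotone[of "x + t *\<^sub>R b" x] by simp
      then show "0 * t \<le> N (x + t *\<^sub>R b) \<bullet> b - N x \<bullet> b"
        using t by (simp add: zero_le_mult_iff inner_diff_left)
    qed (use b nn in \<open>auto simp: infdist_nonneg\<close>)
    show "integrable lborel (\<lambda>x. (N x \<bullet> b) * (?g x \<bullet> b))"
      by (rule difference_quotient_weak_limit(3)[OF rf _ mNb bdd]) (use b in auto)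
  qed
  have pt: "(\<Sum>b\<in>Basis. (N x \<bullet> b) * (?g x \<bullet> b)) = X x \<bullet> g x + f x" for x
  proof (cases "x \<in> S")
    case True
    then have x: "x \<in> - K" using S by auto
    have "(\<Sum>b\<in>Basis. (N x \<bullet> b) * (?g x \<bullet> b)) = N x \<bullet> ?g x" by (rule euclidean_inner[symmetric])
    also have "\<dots> = (r x * inverse (r x)) * (X x \<bullet> g x) + f x * (N x \<bullet> N x)"
      by (simp add: inner_add_right N_def)
    also have "N x \<bullet> N x = 1"
      using r_pos[OF x] N_inner[OF x] by (simp add: N_def)
    finally show ?thesis using r_pos[OF x] by simp
  qed (simp add: C1cD(4)[OF f] C1c_gradient_eq_0[OF f])
  have intf: "integrable lborel f" using C1cD[OF f] by (intro integrable_compact_support[of S]) auto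
  have "0 \<le> (\<Sum>b\<in>Basis. - (\<integral>x. (N x \<bullet> b) * (?g x \<bullet> b) \<partial>lborel))"
    using zero by (intro sum_nonneg) auto
  also have "\<dots> = - (\<integral>x. (\<Sum>b\<in>Basis. (N x \<bullet> b) * (?g x \<bullet> b)) \<partial>lborel)"
    using int by (subst Bochner_Integration.integral_sum) (auto simp: sum_negf)
  also have "\<dots> = - ((\<integral>x. X x \<bullet> g x \<partial>lborel) + (\<integral>x. f x \<partial>lborel))"
    unfolding pt using integrable_X_inner[OF f] intf by simp
  finally show ?thesis by simp
qed

end

section \<open>Energy estimate by completing the square\<close>

text \<open>
  The sum over \<open>v e x \<bullet> e\<close> is the divergence of the field with components \<open>U e\<close>, and the derivative of each
  product \<open>U e * \<psi>\<close> in direction \<open>e\<close> has integral zero.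
\<close>

lemma integral_divergence_mult:
  fixes U :: "'a::euclidean_space \<Rightarrow> 'a \<Rightarrow> real"
  assumes U: "\<And>e. e \<in> Basis \<Longrightarrow> C1c S (U e) (v e)" and \<psi>: "C1c S \<psi> h"
  shows "(\<integral>x. - (\<Sum>e\<in>Basis. v e x \<bullet> e) * \<psi> x \<partial>lborel) = (\<integral>x. (\<Sum>e\<in>Basis. U e x * (h x \<bullet> e)) \<partial>lborel)"
proof -
  note [simp] = C1c_gradient_eq_0[OF \<psi>] C1cD(4)[OF \<psi>]
  have int1: "integrable lborel (\<lambda>x. (v e x \<bullet> e) * \<psi> x)"
    and int2: "integrable lborel (\<lambda>x. U e x * (h x \<bullet> e))"
    and eq: "(\<integral>x. (v e x \<bullet> e) * \<psi> x \<partial>lborel) = - (\<integral>x. U e x * (h x \<bullet> e) \<partial>lborel)"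
    if e: "e \<in> Basis" for e
  proof -
    show 1: "integrable lborel (\<lambda>x. (v e x \<bullet> e) * \<psi> x)"
      by (intro integrable_compact_support[of S] continuous_intros C1cD[OF \<psi>] C1cD(2)[OF U[OF e]]) auto
    show 2: "integrable lborel (\<lambda>x. U e x * (h x \<bullet> e))"
      by (intro integrable_compact_support[of S] continuous_intros C1cD[OF \<psi>] C1cD(5)[OF U[OF e]]) auto
    have "C1c S (\<lambda>x. U e x * \<psi> x) (\<lambda>x. U e x *\<^sub>R h x + \<psi> x *\<^sub>R v e x)"
      by (rule C1c_mult[OF \<psi>, of UNIV]) (use C1cD[OF U[OF e]] in auto)
    from integral_directional_derivative_eq_0[OF this, of e]
    have "(\<integral>x. U e x * (h x \<bullet> e) + (v e x \<bullet> e) * \<psi> x \<partial>lborel) = 0"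
      using e by (simp add: inner_add_left mult.commute)
    then show "(\<integral>x. (v e x \<bullet> e) * \<psi> x \<partial>lborel) = - (\<integral>x. U e x * (h x \<bullet> e) \<partial>lborel)"
      using 1 2 by simp
  qed
  show ?thesis
    using int1 int2 eq by (simp add: sum_distrib_right sum_negf)
qed

context closed_convex
begin

text \<open>
  The energy \<open>\<integral> c(r) \<nabla>\<phi> \<bullet> \<nabla>(w(r) f(\<phi>))\<close> is bounded below by completing a square, which exchanges the term
  quadratic in \<open>\<nabla>\<phi>\<close> for one linear in \<open>\<nabla>\<phi>\<close>. The latter is the part \<open>m(r) X \<bullet> \<nabla>F(\<phi>)\<close> of \<open>X \<bullet> \<nabla>\<zeta>\<close> for
  \<open>\<zeta> = m(r) F(\<phi>)\<close>, to which the assumption on the divergence of \<open>X\<close> applies. The parameter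
  \<open>\<beta>\<close> is free, and optimising it later reproduces the constant of the Hardy inequality.
\<close>

lemma energy_ge:
  fixes c w w' m m' G q f f' F :: "real \<Rightarrow> real"
  assumes \<phi>: "C1c S \<phi> g" and S: "S \<subseteq> - K"
    and flux: "\<And>e. e \<in> Basis \<Longrightarrow> C1c S (\<lambda>x. c (r x) * (g x \<bullet> e)) (v e)"
    and div: "\<And>\<zeta> h. C1c S \<zeta> h \<Longrightarrow> (\<And>x. \<zeta> x \<ge> 0) \<Longrightarrow> - (\<integral>x. X x \<bullet> h x \<partial>lborel) \<ge> k * (\<integral>x. \<zeta> x \<partial>lborel)"
    and w: "\<And>s. s > 0 \<Longrightarrow> (w has_real_derivative w' s) (at s)" "continuous_on {0<..} w'"
    and m: "\<And>s. s > 0 \<Longrightarrow> (m has_real_derivative m' s) (at s)" "continuous_on {0<..} m'"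
    and G: "continuous_on {0<..} G" "\<And>s. s > 0 \<Longrightarrow> G s \<ge> 0"
    and cw: "\<And>s. s > 0 \<Longrightarrow> c s * w s = G s * s\<^sup>2" "\<And>s. s > 0 \<Longrightarrow> c s * w' s = - q s * G s * s"
    and meq: "\<And>s. s > 0 \<Longrightarrow> m s = (2 * \<beta> + q s) * G s" and m0: "\<And>s. s > 0 \<Longrightarrow> m s \<ge> 0"
    and f: "\<And>t. (f has_real_derivative f' t) (at t)" "continuous_on UNIV f'" "f 0 = 0" "\<And>t. f' t > 0"
    and F: "\<And>t. (F has_real_derivative f t) (at t)" "F 0 = 0" "\<And>t. F t \<ge> 0"
  shows "(\<integral>x. - (\<Sum>e\<in>Basis. v e x \<bullet> e) * (w (r x) * f (\<phi> x)) \<partial>lborel) \<ge>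
    (\<integral>x. (k * m (r x) + r x * m' (r x)) * F (\<phi> x) - \<beta>\<^sup>2 * (G (r x) * ((f (\<phi> x))\<^sup>2 / f' (\<phi> x))) \<partial>lborel)"
proof -
  have cf: "continuous_on UNIV f" using f(1) by (meson DERIV_isCont continuous_at_imp_continuous_on)
  have cF: "continuous_on UNIV F" using F(1) by (meson DERIV_isCont continuous_at_imp_continuous_on)
  have cm: "continuous_on {0<..} m" using m(1) by (meson DERIV_isCont continuous_at_imp_continuous_on greaterThan_iff)
  define h where "h x = w (r x) *\<^sub>R (f' (\<phi> x) *\<^sub>R g x) + f (\<phi> x) *\<^sub>R (w' (r x) *\<^sub>R N x)" for x
  define z where "z x = m (r x) *\<^sub>R (f (\<phi> x) *\<^sub>R g x) + F (\<phi> x) *\<^sub>R (m' (r x) *\<^sub>R N x)" for x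
  have \<psi>: "C1c S (\<lambda>x. w (r x) * f (\<phi> x)) h"
    unfolding h_def[abs_def] by (rule C1c_radial_mult[OF C1c_compose[OF \<phi> f(1,2,3)] S w])
  have \<zeta>: "C1c S (\<lambda>x. m (r x) * F (\<phi> x)) z"
    unfolding z_def[abs_def] by (rule C1c_radial_mult[OF C1c_compose[OF \<phi> F(1) cf F(2)] S m])
  have \<zeta>0: "m (r x) * F (\<phi> x) \<ge> 0" for x
  proof (cases "x \<in> S")
    case True
    then show ?thesis using S m0[OF r_pos[of x]] F(3) by auto
  qed (simp add: C1cD(4)[OF \<phi>] F(2))
  let ?R = "\<lambda>x. m' (r x) * r x * F (\<phi> x) - \<beta>\<^sup>2 * (G (r x) * ((f (\<phi> x))\<^sup>2 / f' (\<phi> x)))"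
  have cr: "continuous_on S (\<lambda>x. u (r x))" if "continuous_on {0<..} u" for u :: "real \<Rightarrow> real"
    using continuous_radial[OF that] S by (rule continuous_on_subset)
  have c\<phi>: "continuous_on S (\<lambda>x. u (\<phi> x))" if "continuous_on UNIV u" for u :: "real \<Rightarrow> real"
    by (rule continuous_on_compose2[OF that C1cD(5)[OF \<phi>]]) auto
  have f'0: "f' t \<noteq> 0" for t using f(4)[of t] by simp
  have intR: "integrable lborel ?R"
    by (intro integrable_compact_support[of S] continuous_intros cr c\<phi> m G cF cf f C1cD(1)[OF \<phi>] continuous_r)
       (auto simp: C1cD(4)[OF \<phi>] F(2) f(3) f'0)
  have intm: "integrable lborel (\<lambda>x. m (r x) * F (\<phi> x))"
    using C1cD[OF \<zeta>] by (intro integrable_compact_support[of S]) auto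
  have pt: "(\<Sum>e\<in>Basis. c (r x) * (g x \<bullet> e) * (h x \<bullet> e)) \<ge> - (X x \<bullet> z x) + ?R x" for x
  proof (cases "x \<in> S")
    case True
    then have x: "x \<in> - K" using S by auto
    note rp = r_pos[OF x]
    let ?s = "r x" and ?f = "f (\<phi> x)" and ?f' = "f' (\<phi> x)"
    have fp: "?f' > 0" by (rule f(4))
    have "(\<Sum>e\<in>Basis. c ?s * (g x \<bullet> e) * (h x \<bullet> e)) = c ?s * (\<Sum>e\<in>Basis. (g x \<bullet> e) * (h x \<bullet> e))"
      by (simp add: sum_distrib_left mult.assoc)
    also have "\<dots> = c ?s * (g x \<bullet> h x)" by (simp add: euclidean_inner[of "g x" "h x"])
    also have "\<dots> = (c ?s * w ?s) * ?f' * (g x \<bullet> g x) + (c ?s * w' ?s) * ?f * (g x \<bullet> N x)"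
      by (simp add: h_def inner_add_right algebra_simps)
    also have "\<dots> = G ?s * ?f' * (?s\<^sup>2 * (g x \<bullet> g x)) - q ?s * G ?s * ?f * (g x \<bullet> X x)"
      unfolding cw[OF rp] using rp by (simp add: N_def)
    finally have lhs: "(\<Sum>e\<in>Basis. c ?s * (g x \<bullet> e) * (h x \<bullet> e)) = \<dots>" .
    have "X x \<bullet> z x = m ?s * ?f * (g x \<bullet> X x) + F (\<phi> x) * m' ?s * (X x \<bullet> N x)"
      by (simp add: z_def inner_add_right inner_commute)
    then have rhs: "X x \<bullet> z x = (2 * \<beta> + q ?s) * G ?s * ?f * (g x \<bullet> X x) + F (\<phi> x) * m' ?s * ?s"
      unfolding N_inner[OF x] meq[OF rp] by simp
    \<comment> \<open>the square to be completed; its weight in \<open>X x\<close> is chosen so that the mixed term has coefficient \<open>2 \<beta>\<close>\<close>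
    define a where "a = ?s *\<^sub>R g x + (\<beta> * ?f / (?f' * ?s)) *\<^sub>R X x"
    have "0 \<le> G ?s * ?f' * (a \<bullet> a)" using G(2)[OF rp] fp by simp
    also have "a \<bullet> a = ?s\<^sup>2 * (g x \<bullet> g x) + 2 * (?s * (\<beta> * ?f / (?f' * ?s))) * (g x \<bullet> X x)
        + (\<beta> * ?f / (?f' * ?s))\<^sup>2 * ?s\<^sup>2"
      unfolding a_def
      by (simp add: inner_add_left inner_add_right inner_commute X_inner_X power2_eq_square algebra_simps)
    also have "?s * (\<beta> * ?f / (?f' * ?s)) = \<beta> * ?f / ?f'" using rp by simp
    also have "(\<beta> * ?f / (?f' * ?s))\<^sup>2 * ?s\<^sup>2 = \<beta>\<^sup>2 * ?f\<^sup>2 / ?f'\<^sup>2"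
      using rp by (simp add: power_divide power_mult_distrib)
    also have "G ?s * ?f' * (?s\<^sup>2 * (g x \<bullet> g x) + 2 * (\<beta> * ?f / ?f') * (g x \<bullet> X x) + \<beta>\<^sup>2 * ?f\<^sup>2 / ?f'\<^sup>2)
      = G ?s * ?f' * (?s\<^sup>2 * (g x \<bullet> g x)) + 2 * \<beta> * G ?s * ?f * (g x \<bullet> X x) + \<beta>\<^sup>2 * (G ?s * (?f\<^sup>2 / ?f'))"
      using fp by (simp add: field_simps power2_eq_square)
    finally show ?thesis unfolding lhs rhs by (simp add: algebra_simps)
  next
    case False
    then show ?thesis
      using C1c_gradient_eq_0[OF \<phi>] C1c_gradient_eq_0[OF \<zeta>] C1cD(4)[OF \<phi>] f(3) F(2) by simp
  qed
  have intS: "integrable lborel (\<lambda>x. \<Sum>e\<in>Basis. c (r x) * (g x \<bullet> e) * (h x \<bullet> e))"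
    by (intro Bochner_Integration.integrable_sum integrable_compact_support[of S] continuous_intros C1cD[OF \<psi>] C1cD(5)[OF flux])
       (auto simp: C1c_gradient_eq_0[OF \<phi>])
  note intX = integrable_X_inner[OF \<zeta>]
  have "(\<integral>x. (k * m (r x) + r x * m' (r x)) * F (\<phi> x) - \<beta>\<^sup>2 * (G (r x) * ((f (\<phi> x))\<^sup>2 / f' (\<phi> x))) \<partial>lborel)
      = (\<integral>x. k * (m (r x) * F (\<phi> x)) + ?R x \<partial>lborel)"
    by (rule Bochner_Integration.integral_cong) (auto simp: algebra_simps)
  also have "\<dots> = k * (\<integral>x. m (r x) * F (\<phi> x) \<partial>lborel) + (\<integral>x. ?R x \<partial>lborel)"
    using intR intm by (subst Bochner_Integration.integral_add) auto
  also have "\<dots> \<le> - (\<integral>x. X x \<bullet> z x \<partial>lborel) + (\<integral>x. ?R x \<partial>lborel)"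
    using div[OF \<zeta> \<zeta>0] by simp
  also have "\<dots> = (\<integral>x. - (X x \<bullet> z x) + ?R x \<partial>lborel)"
    using intX intR by (subst Bochner_Integration.integral_add) auto
  also have "\<dots> \<le> (\<integral>x. (\<Sum>e\<in>Basis. c (r x) * (g x \<bullet> e) * (h x \<bullet> e)) \<partial>lborel)"
    by (rule integral_mono[OF _ intS pt]) (use intX intR in auto)
  also have "\<dots> = (\<integral>x. - (\<Sum>e\<in>Basis. v e x \<bullet> e) * (w (r x) * f (\<phi> x)) \<partial>lborel)"
    using integral_divergence_mult[OF flux \<psi>] by simp
  finally show ?thesis .
qed

end

section \<open>The weights and the Rellich inequality\<close>

text \<open>
  The local exponent \<open>s c'(s) / c(s)\<close> of the weight \<open>c\<close>, which moves from \<open>\<delta>\<close> at \<open>s = 0\<close> to \<open>\<delta>'\<close> at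
  infinity.
\<close>

definition weight_exponent :: "real \<Rightarrow> real \<Rightarrow> real \<Rightarrow> real" where
  "weight_exponent \<delta> \<delta>' s = \<delta> + (\<delta>' - \<delta>) * (s / (1 + s))"

lemma weight_pos: "s > 0 \<Longrightarrow> weight \<delta> \<delta>' s > 0"
  by (simp add: weight_def)

lemma DERIV_weight:
  assumes "s > 0"
  shows "(weight \<delta> \<delta>' has_real_derivative weight \<delta> \<delta>' s * weight_exponent \<delta> \<delta>' s / s) (at s)"
proof -
  have "((\<lambda>s. s powr \<delta> * (1 + s) powr (\<delta>' - \<delta>)) has_real_derivative
     \<delta> * s powr (\<delta> - 1) * (1 + s) powr (\<delta>' - \<delta>) + (\<delta>' - \<delta>) * (1 + s) powr (\<delta>' - \<delta> - 1) * s powr \<delta>) (at s)"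
    using assms by (auto intro!: derivative_eq_intros)
  also have "\<delta> * s powr (\<delta> - 1) * (1 + s) powr (\<delta>' - \<delta>) + (\<delta>' - \<delta>) * (1 + s) powr (\<delta>' - \<delta> - 1) * s powr \<delta>
     = s powr \<delta> * (1 + s) powr (\<delta>' - \<delta>) * weight_exponent \<delta> \<delta>' s / s"
  proof -
    define u where "u = s powr \<delta>"
    define y where "y = (1 + s) powr (\<delta>' - \<delta>)"
    have "s powr (\<delta> - 1) = u / s" "(1 + s) powr (\<delta>' - \<delta> - 1) = y / (1 + s)"
      using assms by (simp_all add: u_def y_def powr_diff[of _ _ 1])
    moreover have "\<delta> * (u / s) * y + (\<delta>' - \<delta>) * (y / (1 + s)) * u = u * y * (\<delta> + (\<delta>' - \<delta>) * (s / (1 + s))) / s"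
      using assms by (simp add: field_simps)
    ultimately show ?thesis
      unfolding weight_exponent_def by (simp only: u_def[symmetric] y_def[symmetric])
  qed
  finally show ?thesis unfolding weight_def[abs_def] .
qed

lemma DERIV_weight_exponent:
  assumes "s > 0"
  shows "(weight_exponent \<delta> \<delta>' has_real_derivative (\<delta>' - \<delta>) / (1 + s)\<^sup>2) (at s)"
  unfolding weight_exponent_def[abs_def] using assms
  by (auto intro!: derivative_eq_intros simp: power2_eq_square field_simps)

lemma weight_exponent_bounds:
  assumes "s > 0"
  shows "min \<delta> \<delta>' \<le> weight_exponent \<delta> \<delta>' s" "weight_exponent \<delta> \<delta>' s \<le> max \<delta> \<delta>'"
proof -
  define t where "t = s / (1 + s)"
  have t: "0 \<le> t" "t \<le> 1" using assms by (auto simp: t_def)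
  have eq: "weight_exponent \<delta> \<delta>' s = (1 - t) * \<delta> + t * \<delta>'"
    by (simp add: weight_exponent_def t_def[symmetric] algebra_simps)
  show "min \<delta> \<delta>' \<le> weight_exponent \<delta> \<delta>' s" unfolding eq
    using convex_bound_le[of "-\<delta>" "- min \<delta> \<delta>'" "-\<delta>'" "1 - t" t] t by (simp add: algebra_simps)
  show "weight_exponent \<delta> \<delta>' s \<le> max \<delta> \<delta>'" unfolding eq
    using convex_bound_le[of "\<delta>" "max \<delta> \<delta>'" "\<delta>'" "1 - t" t] t by simp
qed

definition hardy_weight :: "real \<Rightarrow> real \<Rightarrow> real \<Rightarrow> real" where
  "hardy_weight \<delta> \<delta>' s = weight \<delta> \<delta>' s / s\<^sup>2"

lemma hardy_weight_pos: "s > 0 \<Longrightarrow> hardy_weight \<delta> \<delta>' s > 0"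
  by (simp add: hardy_weight_def weight_pos)

lemma DERIV_hardy_weight_powr:
  assumes "s > 0"
  shows "((\<lambda>s. hardy_weight \<delta> \<delta>' s powr \<alpha>) has_real_derivative
     \<alpha> * hardy_weight \<delta> \<delta>' s powr \<alpha> * (weight_exponent \<delta> \<delta>' s - 2) / s) (at s)"
proof -
  let ?D = "hardy_weight \<delta> \<delta>' s * (weight_exponent \<delta> \<delta>' s - 2) / s"
  have "(hardy_weight \<delta> \<delta>' has_real_derivative ?D) (at s)"
    unfolding hardy_weight_def[abs_def]
    by (rule DERIV_cong[OF DERIV_divide[OF DERIV_weight[OF assms] DERIV_power[OF DERIV_ident]]])
       (use assms in \<open>auto simp: field_simps power2_eq_square\<close>)
  then have "((\<lambda>s. hardy_weight \<delta> \<delta>' s powr \<alpha>) has_real_derivative \<alpha> * hardy_weight \<delta> \<delta>' s powr (\<alpha> - 1) * ?D) (at s)"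
    using hardy_weight_pos[OF assms] by (auto intro!: derivative_eq_intros)
  then show ?thesis using hardy_weight_pos[OF assms, of \<delta> \<delta>'] by (simp add: powr_diff abs_of_pos mult.assoc)
qed

lemma continuous_weight_exponent: "continuous_on {0<..} (weight_exponent \<delta> \<delta>')"
  using DERIV_weight_exponent by (meson DERIV_isCont continuous_at_imp_continuous_on greaterThan_iff)

lemma continuous_hardy_weight_powr: "continuous_on {0<..} (\<lambda>s. hardy_weight \<delta> \<delta>' s powr \<alpha>)"
  using DERIV_hardy_weight_powr by (meson DERIV_isCont continuous_at_imp_continuous_on greaterThan_iff)

text \<open>
  A \<open>C\<^sup>1\<close> substitute for \<open>t \<bar>t\<bar>\<^bsup>p-2\<^esup>\<close>, whose derivative is singular at \<open>0\<close> when \<open>p < 2\<close>.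
\<close>

lemma DERIV_regularised_power:
  fixes p \<epsilon> :: real
  assumes "\<epsilon> > 0"
  shows "((\<lambda>t. t * (t\<^sup>2 + \<epsilon>) powr ((p - 2) / 2)) has_real_derivative
           (t\<^sup>2 + \<epsilon>) powr ((p - 4) / 2) * ((p - 1) * t\<^sup>2 + \<epsilon>)) (at t)"
proof -
  have pos: "t\<^sup>2 + \<epsilon> > 0" using assms by (simp add: add_nonneg_pos)
  have "((\<lambda>t. t * (t\<^sup>2 + \<epsilon>) powr ((p - 2) / 2)) has_real_derivative
     (t\<^sup>2 + \<epsilon>) powr ((p - 2) / 2) + t * ((p - 2) / 2 * (t\<^sup>2 + \<epsilon>) powr ((p - 2) / 2 - 1) * (2 * t))) (at t)"
    using pos by (auto intro!: derivative_eq_intros)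
  also have "(p - 2) / 2 - 1 = (p - 4) / 2" by (simp add: field_simps)
  also have "(t\<^sup>2 + \<epsilon>) powr ((p - 2) / 2) = (t\<^sup>2 + \<epsilon>) powr ((p - 4) / 2) * (t\<^sup>2 + \<epsilon>)"
  proof -
    have "(p - 2) / 2 = (p - 4) / 2 + 1" by (simp add: field_simps)
    then show ?thesis using pos by (simp only: powr_add) simp
  qed
  also have "(t\<^sup>2 + \<epsilon>) powr ((p - 4) / 2) * (t\<^sup>2 + \<epsilon>) + t * ((p - 2) / 2 * (t\<^sup>2 + \<epsilon>) powr ((p - 4) / 2) * (2 * t))
     = (t\<^sup>2 + \<epsilon>) powr ((p - 4) / 2) * ((p - 1) * t\<^sup>2 + \<epsilon>)"
    by (simp add: field_simps power2_eq_square)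
  finally show ?thesis .
qed

lemma DERIV_regularised_primitive:
  fixes p \<epsilon> :: real
  assumes "\<epsilon> > 0" "p > 0"
  shows "((\<lambda>t. ((t\<^sup>2 + \<epsilon>) powr (p / 2) - \<epsilon> powr (p / 2)) / p) has_real_derivative
           t * (t\<^sup>2 + \<epsilon>) powr ((p - 2) / 2)) (at t)"
proof -
  have pos: "t\<^sup>2 + \<epsilon> > 0" using assms by (simp add: add_nonneg_pos)
  have "((\<lambda>t. ((t\<^sup>2 + \<epsilon>) powr (p / 2) - \<epsilon> powr (p / 2)) / p) has_real_derivative
      (p / 2 * (t\<^sup>2 + \<epsilon>) powr (p / 2 - 1) * (2 * t)) / p) (at t)"
    using pos assms by (auto intro!: derivative_eq_intros)
  also have "(p / 2 * (t\<^sup>2 + \<epsilon>) powr (p / 2 - 1) * (2 * t)) / p = t * (t\<^sup>2 + \<epsilon>) powr ((p - 2) / 2)"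
    using assms by (simp add: diff_divide_distrib)
  finally show ?thesis .
qed

lemma regularised_power_le:
  fixes p \<epsilon> t :: real
  assumes "\<epsilon> > 0"
  shows "\<bar>t * (t\<^sup>2 + \<epsilon>) powr ((p - 2) / 2)\<bar> \<le> (t\<^sup>2 + \<epsilon>) powr ((p - 1) / 2)"
proof -
  have pos: "t\<^sup>2 + \<epsilon> > 0" using assms by (simp add: add_nonneg_pos)
  have "\<bar>t\<bar> \<le> (t\<^sup>2 + \<epsilon>) powr (1 / 2)"
    using assms by (simp add: powr_half_sqrt[OF less_imp_le[OF pos]] real_le_rsqrt)
  then have "\<bar>t\<bar> * (t\<^sup>2 + \<epsilon>) powr ((p - 2) / 2) \<le> (t\<^sup>2 + \<epsilon>) powr (1 / 2) * (t\<^sup>2 + \<epsilon>) powr ((p - 2) / 2)"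
    by (rule mult_right_mono) simp
  also have "\<dots> = (t\<^sup>2 + \<epsilon>) powr ((p - 1) / 2)"
    by (simp add: powr_add[symmetric] field_simps)
  finally show ?thesis by (simp add: abs_mult)
qed

lemma regularised_quotient_le:
  fixes p \<epsilon> t :: real
  assumes "\<epsilon> > 0" "p > 1"
  shows "(t * (t\<^sup>2 + \<epsilon>) powr ((p - 2) / 2))\<^sup>2 / ((t\<^sup>2 + \<epsilon>) powr ((p - 4) / 2) * ((p - 1) * t\<^sup>2 + \<epsilon>))
           \<le> (t\<^sup>2 + \<epsilon>) powr (p / 2) / (p - 1)"
proof -
  have pos: "t\<^sup>2 + \<epsilon> > 0" using assms by (simp add: add_nonneg_pos)
  have pos2: "(p - 1) * t\<^sup>2 + \<epsilon> > 0" using assms by (simp add: add_nonneg_pos)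
  have "((t\<^sup>2 + \<epsilon>) powr ((p - 2) / 2))\<^sup>2 = (t\<^sup>2 + \<epsilon>) powr (p / 2) * (t\<^sup>2 + \<epsilon>) powr ((p - 4) / 2)"
  proof -
    have "(p - 2) / 2 + (p - 2) / 2 = p / 2 + (p - 4) / 2" by (simp add: field_simps)
    then show ?thesis by (simp only: power2_eq_square[of "_ powr _"] powr_add[symmetric])
  qed
  note sq = this
  have "(t * (t\<^sup>2 + \<epsilon>) powr ((p - 2) / 2))\<^sup>2 / ((t\<^sup>2 + \<epsilon>) powr ((p - 4) / 2) * ((p - 1) * t\<^sup>2 + \<epsilon>))
      = (t\<^sup>2 + \<epsilon>) powr (p / 2) * (t\<^sup>2 / ((p - 1) * t\<^sup>2 + \<epsilon>))"
  proof -
    have "t\<^sup>2 * (B * A) / (A * C) = B * (t\<^sup>2 / C)" if "A > 0" for A B C :: real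
      using that by simp
    then show ?thesis using pos by (simp only: power_mult_distrib sq) simp
  qed
  also have "\<dots> \<le> (t\<^sup>2 + \<epsilon>) powr (p / 2) * (1 / (p - 1))"
    using pos2 assms by (intro mult_left_mono) (auto simp: field_simps)
  finally show ?thesis by simp
qed

text \<open>
  Young's inequality for \<open>x / c\<close> and \<open>R\<^bsup>p-1\<^esup> T\<^bsup>(p-1)/2\<^esup>\<close>. The scaling by \<open>c\<close> is chosen so that the last
  term takes up the fraction \<open>(p - 1) / p\<close> of a lower bound of the form \<open>c R\<^bsup>p\<^esup> T\<^bsup>p/2\<^esup>\<close>, and the first
  term is left to carry the remaining \<open>1 / p\<close>.
\<close>

lemma regularised_young:
  fixes x R T p c :: real
  assumes "c > 0" "p > 1" "x \<ge> 0" "R > 0" "T > 0"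
  shows "x * (R powr (p - 1) * T powr ((p - 1) / 2))
           \<le> c / p * (x / c) powr p + (p - 1) / p * c * (R powr p * T powr (p / 2))"
proof -
  let ?q = "p / (p - 1)" and ?b = "R powr (p - 1) * T powr ((p - 1) / 2)"
  have "(x / c) * ?b \<le> (x / c) powr p / p + ?b powr ?q / ?q"
    using assms by (intro Youngs_inequality) (auto simp: field_simps)
  also have "?b powr ?q = R powr p * T powr (p / 2)"
  proof -
    have "(p - 1) * ?q = p" "(p - 1) / 2 * ?q = p / 2" using assms by (simp_all add: field_simps)
    then show ?thesis using assms by (simp only: powr_mult powr_powr powr_ge_zero)
  qed
  finally have "c * ((x / c) * ?b) \<le> c * ((x / c) powr p / p + (R powr p * T powr (p / 2)) / ?q)"
    using assms by (intro mult_left_mono) auto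
  then show ?thesis using assms by (simp add: algebra_simps)
qed

text \<open>
  For \<open>\<delta> = \<delta>'\<close> the value is \<open>C\<close>. For \<open>\<delta> \<noteq> \<delta>'\<close> the factor \<open>k\<close> is lowered to \<open>b \<le> k\<close>.
\<close>

definition rellich_const :: "real \<Rightarrow> real \<Rightarrow> real \<Rightarrow> real \<Rightarrow> real" where
  "rellich_const k p \<delta> \<delta>' = (let b = k + p * min \<delta> \<delta>' - 2 * p
     in (p - 1) * (if \<delta> = \<delta>' then k else b) * b / p\<^sup>2)"

text \<open>
  The left side is the coefficient of \<open>G(r) \<bar>\<phi>\<bar>\<^bsup>p\<^esup>\<close> produced by the energy estimate. Since \<open>a \<ge> \<delta> \<and> \<delta>'\<close>, the
  factor \<open>k - p (2 - a)\<close> is at least \<open>b\<close>. The choice of \<open>\<beta>\<close> maximises \<open>2 b \<beta> / p - \<beta>\<^sup>2 / (p - 1)\<close>, and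
  the maximum is \<open>(p - 1) b\<^sup>2 / p\<^sup>2\<close>. There remains \<open>b (2 - a) - s a'\<close>: for \<open>\<delta> = \<delta>'\<close> it equals
  \<open>b (2 - \<delta>)\<close>, which completes \<open>b\<close> to \<open>b + p (2 - \<delta>) = k\<close>; otherwise it is non-negative, because
  \<open>\<bar>s a'\<bar> \<le> \<bar>\<delta> - \<delta>'\<bar>\<close> while \<open>b (2 - a) \<ge> 2 p \<bar>\<delta> - \<delta>'\<bar>\<close> by the assumption on \<open>b\<close>.
\<close>

lemma weight_coefficient_bound:
  fixes k p \<delta> \<delta>' s :: real
  defines "b \<equiv> k + p * min \<delta> \<delta>' - 2 * p"
  defines "\<beta> \<equiv> (p - 1) * b / p" and "a \<equiv> weight_exponent \<delta> \<delta>' s"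
  assumes s: "s > 0" and p: "p > 1" and del: "\<delta> < 2" "\<delta>' < 2"
    and cond: "b \<ge> 2 * p * \<bar>\<delta> - \<delta>'\<bar> / (2 - max \<delta> \<delta>')"
  shows "((k - p * (2 - a)) * (2 * \<beta> + (p - 1) * (2 - a)) - (p - 1) * (s * ((\<delta>' - \<delta>) / (1 + s)\<^sup>2))) / p
           - \<beta>\<^sup>2 / (p - 1) \<ge> rellich_const k p \<delta> \<delta>'"
proof -
  have a: "min \<delta> \<delta>' \<le> a" "a \<le> max \<delta> \<delta>'" "a < 2"
    using weight_exponent_bounds[OF s, of \<delta> \<delta>'] del unfolding a_def by auto
  have b0: "b \<ge> 0"
    using cond p del by (smt (verit, best) divide_nonneg_nonneg mult_nonneg_nonneg)
  have \<beta>0: "\<beta> \<ge> 0" using b0 p by (simp add: \<beta>_def)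
  have \<beta>2: "\<beta>\<^sup>2 / (p - 1) = (p - 1) * b\<^sup>2 / p\<^sup>2"
    using p by (simp add: \<beta>_def power2_eq_square field_simps)
  have "k - p * (2 - a) \<ge> b"
    using mult_left_mono[OF a(1), of p] p by (simp add: b_def algebra_simps)
  then have "b * (2 * \<beta> + (p - 1) * (2 - a)) \<le> (k - p * (2 - a)) * (2 * \<beta> + (p - 1) * (2 - a))"
    using \<beta>0 a p by (intro mult_right_mono) auto
  then have "(b * (2 * \<beta> + (p - 1) * (2 - a)) - (p - 1) * (s * ((\<delta>' - \<delta>) / (1 + s)\<^sup>2))) / p - \<beta>\<^sup>2 / (p - 1)
     \<le> ((k - p * (2 - a)) * (2 * \<beta> + (p - 1) * (2 - a)) - (p - 1) * (s * ((\<delta>' - \<delta>) / (1 + s)\<^sup>2))) / p - \<beta>\<^sup>2 / (p - 1)"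
    using p by (simp add: divide_right_mono)
  moreover have "(b * (2 * \<beta> + (p - 1) * (2 - a)) - (p - 1) * (s * ((\<delta>' - \<delta>) / (1 + s)\<^sup>2))) / p - \<beta>\<^sup>2 / (p - 1)
      = (p - 1) * b\<^sup>2 / p\<^sup>2 + (p - 1) / p * (b * (2 - a) - s * ((\<delta>' - \<delta>) / (1 + s)\<^sup>2))"
    unfolding \<beta>2 unfolding \<beta>_def using p by (simp add: field_simps power2_eq_square)
  moreover have "\<dots> \<ge> rellich_const k p \<delta> \<delta>'"
  proof (cases "\<delta> = \<delta>'")
    case True
    then have "a = \<delta>" by (simp add: a_def weight_exponent_def)
    then show ?thesis using True p
      by (simp add: rellich_const_def Let_def b_def field_simps power2_eq_square)
  next
    case False
    have "s / (1 + s)\<^sup>2 \<le> 1"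
    proof -
      have "s \<le> (1 + s)\<^sup>2" using s by (simp add: power2_eq_square algebra_simps)
      then show ?thesis using s by simp
    qed
    then have "s / (1 + s)\<^sup>2 * \<bar>\<delta> - \<delta>'\<bar> \<le> 1 * \<bar>\<delta> - \<delta>'\<bar>"
      by (rule mult_right_mono) simp
    moreover have "s / (1 + s)\<^sup>2 * (\<delta>' - \<delta>) \<le> s / (1 + s)\<^sup>2 * \<bar>\<delta> - \<delta>'\<bar>"
      using s by (intro mult_left_mono) auto
    ultimately have "s / (1 + s)\<^sup>2 * (\<delta>' - \<delta>) \<le> 1 * \<bar>\<delta> - \<delta>'\<bar>"
      by linarith
    also have "1 * \<bar>\<delta> - \<delta>'\<bar> \<le> 2 * p * \<bar>\<delta> - \<delta>'\<bar>" using p by (intro mult_right_mono) auto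
    also have "\<dots> \<le> b * (2 - max \<delta> \<delta>')"
      using cond del by (simp add: divide_le_eq)
    also have "\<dots> \<le> b * (2 - a)" using a b0 by (intro mult_left_mono) auto
    finally have "0 \<le> (p - 1) / p * (b * (2 - a) - s * ((\<delta>' - \<delta>) / (1 + s)\<^sup>2))" using p by simp
    then show ?thesis using False
      by (simp add: rellich_const_def Let_def b_def[symmetric] power2_eq_square)
  qed
  ultimately show ?thesis by linarith
qed

context closed_convex
begin

text \<open>
  The energy estimate for the regularised test function, combined with Young's inequality. The terms
  in \<open>T = (\<phi>\<^sup>2 + \<epsilon>)\<^bsup>p/2\<^esup>\<close> have total coefficient \<open>- c G / p \<le> 0\<close>, so \<open>T\<close> may be replaced by the smaller
  \<open>\<bar>\<phi>\<bar>\<^bsup>p\<^esup>\<close>. The only trace of \<open>\<epsilon>\<close> is then \<open>\<epsilon>\<^bsup>p/2\<^esup>\<close> times the fixed number \<open>D / c\<close>.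
\<close>

lemma rellich_inequality:
  fixes k p \<delta> \<delta>' :: real
  assumes \<phi>: "C1c S \<phi> g" and S: "S \<subseteq> - K"
    and flux: "\<And>e. e \<in> Basis \<Longrightarrow> C1c S (\<lambda>x. weight \<delta> \<delta>' (r x) * (g x \<bullet> e)) (v e)"
    and div: "\<And>\<zeta> h. C1c S \<zeta> h \<Longrightarrow> (\<And>x. \<zeta> x \<ge> 0) \<Longrightarrow> - (\<integral>x. X x \<bullet> h x \<partial>lborel) \<ge> k * (\<integral>x. \<zeta> x \<partial>lborel)"
    and p: "p > 1" and del: "\<delta> < 2" "\<delta>' < 2"
    and cond: "k + p * min \<delta> \<delta>' - 2 * p \<ge> 2 * p * \<bar>\<delta> - \<delta>'\<bar> / (2 - max \<delta> \<delta>')"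
    and cpos: "rellich_const k p \<delta> \<delta>' > 0"
  shows "(\<integral>x. \<bar>\<Sum>e\<in>Basis. v e x \<bullet> e\<bar> powr p \<partial>lborel) \<ge>
    rellich_const k p \<delta> \<delta>' powr p * (\<integral>x. \<bar>weight \<delta> \<delta>' (r x) * \<phi> x / (r x)\<^sup>2\<bar> powr p \<partial>lborel)"
proof -
  define c where "c = rellich_const k p \<delta> \<delta>'"
  have c: "c > 0" using cpos by (simp add: c_def)
  define b where "b = k + p * min \<delta> \<delta>' - 2 * p"
  define \<beta> where "\<beta> = (p - 1) * b / p"
  let ?\<rho> = "hardy_weight \<delta> \<delta>'" and ?a = "weight_exponent \<delta> \<delta>'"
  define G where "G s = ?\<rho> s powr p" for s
  define w where "w s = ?\<rho> s powr (p - 1)" for s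
  define w' where "w' s = (p - 1) * ?\<rho> s powr (p - 1) * (?a s - 2) / s" for s
  define q where "q s = (p - 1) * (2 - ?a s)" for s
  define \<alpha> where "\<alpha> s = (\<delta>' - \<delta>) / (1 + s)\<^sup>2" for s
  define m where "m s = (2 * \<beta> + q s) * G s" for s
  define m' where "m' s = - (p - 1) * \<alpha> s * G s
      + (2 * \<beta> + q s) * (p * G s * (?a s - 2) / s)" for s
  \<comment> \<open>the weight that multiplies \<open>F(\<phi>)\<close> in the energy estimate; the derivative of \<open>m\<close> makes it a multiple of \<open>G\<close>\<close>
  define A where "A s = k * m s + s * m' s" for s
  define H where "H x = - (\<Sum>e\<in>Basis. v e x \<bullet> e)" for x
  have G0: "s > 0 \<Longrightarrow> G s > 0" for s using hardy_weight_pos[of s \<delta> \<delta>'] by (simp add: G_def)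
  have q0: "s > 0 \<Longrightarrow> q s \<ge> 0" for s
    using weight_exponent_bounds(2)[of s \<delta> \<delta>'] p del by (simp add: q_def)
  have b0: "b \<ge> 0"
    using cond p del unfolding b_def by (smt (verit, best) divide_nonneg_nonneg mult_nonneg_nonneg)
  have \<beta>0: "\<beta> \<ge> 0" using b0 p by (simp add: \<beta>_def)
  have dw: "s > 0 \<Longrightarrow> (w has_real_derivative w' s) (at s)" for s
    unfolding w_def[abs_def] w'_def by (rule DERIV_hardy_weight_powr)
  have dG: "s > 0 \<Longrightarrow> (G has_real_derivative p * G s * (?a s - 2) / s) (at s)" for s
    unfolding G_def[abs_def] by (rule DERIV_hardy_weight_powr)
  have dq: "s > 0 \<Longrightarrow> (q has_real_derivative - ((p - 1) * \<alpha> s)) (at s)" for s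
    unfolding q_def[abs_def] \<alpha>_def by (auto intro!: derivative_eq_intros DERIV_weight_exponent)
  have dm: "s > 0 \<Longrightarrow> (m has_real_derivative m' s) (at s)" for s
    unfolding m_def[abs_def] m'_def
    by (rule DERIV_cong[OF DERIV_mult[OF DERIV_add[OF DERIV_const dq] dG]]) (simp_all add: algebra_simps)
  have cG: "continuous_on {0<..} G" unfolding G_def[abs_def] by (rule continuous_hardy_weight_powr)
  have cq: "continuous_on {0<..} q"
    unfolding q_def[abs_def] by (intro continuous_intros continuous_weight_exponent)
  have cw': "continuous_on {0<..} w'"
    unfolding w'_def[abs_def] by (intro continuous_intros continuous_weight_exponent continuous_hardy_weight_powr) auto
  have cm': "continuous_on {0<..} m'"
    unfolding m'_def[abs_def] \<alpha>_def by (intro continuous_intros continuous_weight_exponent cG cq) auto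
  have cm: "continuous_on {0<..} m"
    unfolding m_def[abs_def] by (intro continuous_intros cG cq)
  have cA: "continuous_on {0<..} A"
    unfolding A_def[abs_def] by (intro continuous_intros cm cm')
  have wt: "s > 0 \<Longrightarrow> weight \<delta> \<delta>' s = ?\<rho> s * s\<^sup>2" for s by (simp add: hardy_weight_def)
  have cw1: "weight \<delta> \<delta>' s * w s = G s * s\<^sup>2" if "s > 0" for s
    using hardy_weight_pos[OF that, of \<delta> \<delta>'] by (simp add: wt[OF that] w_def G_def powr_diff)
  have cw2: "weight \<delta> \<delta>' s * w' s = - q s * G s * s" if "s > 0" for s
    using hardy_weight_pos[OF that, of \<delta> \<delta>'] that
    by (simp add: wt[OF that] w'_def q_def G_def powr_diff power2_eq_square field_simps)
  have m0: "s > 0 \<Longrightarrow> m s \<ge> 0" for s using G0[of s] q0[of s] \<beta>0 by (simp add: m_def)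
  have Aeq: "A s = G s * ((k - p * (2 - ?a s)) * (2 * \<beta> + q s) - (p - 1) * (s * \<alpha> s))"
    if "s > 0" for s
  proof -
    have "s * (u + y * (z / s)) = s * u + y * z" for u y z :: real
      using that by (simp add: field_simps)
    then have "s * m' s = s * (- (p - 1) * \<alpha> s * G s) + (2 * \<beta> + q s) * (p * G s * (?a s - 2))"
      unfolding m'_def .
    then show ?thesis unfolding A_def m_def by (simp add: algebra_simps)
  qed
  have Abound: "A s / p - \<beta>\<^sup>2 / (p - 1) * G s \<ge> c * G s" if "s > 0" for s
  proof -
    have "G s * c \<le> G s * (((k - p * (2 - ?a s)) * (2 * \<beta> + q s) - (p - 1) * (s * \<alpha> s)) / p
           - \<beta>\<^sup>2 / (p - 1))"
      unfolding c_def \<beta>_def b_def q_def \<alpha>_def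
      by (rule mult_left_mono[OF weight_coefficient_bound[OF that p del cond] less_imp_le[OF G0[OF that]]])
    then show ?thesis unfolding Aeq[OF that] by (simp add: algebra_simps)
  qed
  define E where "E x = \<bar>weight \<delta> \<delta>' (r x) * \<phi> x / (r x)\<^sup>2\<bar> powr p" for x
  have Eeq: "E x = G (r x) * \<bar>\<phi> x\<bar> powr p" if "x \<in> S" for x
  proof -
    have rp: "r x > 0" using that S r_pos by auto
    have "weight \<delta> \<delta>' (r x) * \<phi> x / (r x)\<^sup>2 = ?\<rho> (r x) * \<phi> x" by (simp add: hardy_weight_def)
    then show ?thesis using hardy_weight_pos[OF rp, of \<delta> \<delta>'] by (simp add: E_def G_def abs_mult powr_mult)
  qed
  have cpt: "compact S" using \<phi> by (simp add: C1c_def)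
  have cr: "continuous_on S (\<lambda>x. u (r x))" if "continuous_on {0<..} u" for u :: "real \<Rightarrow> real"
    using continuous_radial[OF that] S by (rule continuous_on_subset)
  have cH: "continuous_on S H"
    unfolding H_def[abs_def] by (intro continuous_intros C1cD(2)[OF flux])
  have H0: "x \<notin> S \<Longrightarrow> H x = 0" for x
    unfolding H_def using C1c_gradient_eq_0[OF flux] by simp
  have \<phi>0: "x \<notin> S \<Longrightarrow> \<phi> x = 0" for x using C1cD(4)[OF \<phi>] .
  have intE: "integrable lborel E"
  proof (rule integrable_compact_support[OF cpt])
    have "continuous_on S (\<lambda>x. G (r x) * \<bar>\<phi> x\<bar> powr p)"
      using p by (intro continuous_intros cr cG C1cD[OF \<phi>] continuous_on_powr') auto
    then show "continuous_on S E" by (rule continuous_on_eq) (simp add: Eeq)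
  qed (simp add: E_def \<phi>0)
  have intH: "integrable lborel (\<lambda>x. (\<bar>H x\<bar> / c) powr p)"
    by (rule integrable_compact_support[OF cpt])
       (use p c in \<open>auto intro!: continuous_intros cH continuous_on_powr' simp: H0\<close>)
  define D where "D = (\<integral>x. indicator S x *\<^sub>R A (r x) \<partial>lborel)"
  have intA: "integrable lborel (\<lambda>x. indicator S x *\<^sub>R A (r x))"
    by (rule borel_integrable_compact[OF cpt cr[OF cA]])
  have main: "(\<integral>x. E x \<partial>lborel) \<le> (\<integral>x. (\<bar>H x\<bar> / c) powr p \<partial>lborel) + \<epsilon> powr (p / 2) * (D / c)"
    if \<epsilon>: "\<epsilon> > 0" for \<epsilon> :: real
  proof -
    define f where "f t = t * (t\<^sup>2 + \<epsilon>) powr ((p - 2) / 2)" for t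
    define f' where "f' t = (t\<^sup>2 + \<epsilon>) powr ((p - 4) / 2) * ((p - 1) * t\<^sup>2 + \<epsilon>)" for t
    define T where "T t = (t\<^sup>2 + \<epsilon>) powr (p / 2)" for t
    define F where "F t = (T t - \<epsilon> powr (p / 2)) / p" for t
    have pos: "t\<^sup>2 + \<epsilon> > 0" "(p - 1) * t\<^sup>2 + \<epsilon> > 0" for t :: real
      using \<epsilon> p by (auto simp: add_nonneg_pos)
    have df: "(f has_real_derivative f' t) (at t)" for t
      unfolding f_def[abs_def] f'_def by (rule DERIV_regularised_power[OF \<epsilon>])
    have dF: "(F has_real_derivative f t) (at t)" for t
      unfolding F_def[abs_def] T_def f_def using \<epsilon> p by (intro DERIV_regularised_primitive) auto
    have f'p: "f' t > 0" for t using pos[of t] by (simp add: f'_def)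
    have cf': "continuous_on UNIV f'"
      unfolding f'_def[abs_def] using pos(1) by (intro continuous_intros) (metis less_irrefl)
    have F0: "F t \<ge> 0" for t
      unfolding F_def T_def using p \<epsilon> by (auto intro!: divide_nonneg_pos powr_mono2)
    have f00: "f 0 = 0" and F00: "F 0 = 0" by (auto simp: f_def F_def T_def)
    let ?L = "\<lambda>x. H x * (w (r x) * f (\<phi> x))"
    let ?R = "\<lambda>x. (k * m (r x) + r x * m' (r x)) * F (\<phi> x) - \<beta>\<^sup>2 * (G (r x) * ((f (\<phi> x))\<^sup>2 / f' (\<phi> x)))"
    have en: "(\<integral>x. ?R x \<partial>lborel) \<le> (\<integral>x. ?L x \<partial>lborel)"
      unfolding H_def
      by (rule energy_ge[OF \<phi> S flux div dw cw' dm cm' cG less_imp_le[OF G0] cw1 cw2 _ m0 df cf' f00 f'p dF F00 F0])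
         (auto simp: m_def)
    have cf: "continuous_on UNIV f" using df by (meson DERIV_isCont continuous_at_imp_continuous_on)
    have cF: "continuous_on UNIV F" using dF by (meson DERIV_isCont continuous_at_imp_continuous_on)
    have c\<phi>: "continuous_on S (\<lambda>x. u (\<phi> x))" if "continuous_on UNIV u" for u :: "real \<Rightarrow> real"
      by (rule continuous_on_compose2[OF that C1cD(5)[OF \<phi>]]) auto
    have cw: "continuous_on {0<..} w" unfolding w_def[abs_def] by (rule continuous_hardy_weight_powr)
    have f'0: "f' t \<noteq> 0" for t using f'p[of t] by simp
    have intL: "integrable lborel ?L"
      by (intro integrable_compact_support[OF cpt] continuous_intros cH cr cw c\<phi> cf) (auto simp: H0)
    have intR: "integrable lborel ?R"
      by (intro integrable_compact_support[OF cpt] continuous_intros cr cm cm' cG c\<phi> cf cF cf' continuous_r)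
         (auto simp: \<phi>0 f00 F00 f'0)
    let ?B = "\<lambda>x. c / p * (((\<bar>H x\<bar> / c) powr p - E x) + \<epsilon> powr (p / 2) / c * (indicator S x *\<^sub>R A (r x)))"
    have pt: "?L x - ?R x \<le> ?B x" for x
    proof (cases "x \<in> S")
      case True
      have rp: "r x > 0" using True S r_pos by auto
      let ?T = "T (\<phi> x)" and ?G = "G (r x)" and ?A = "A (r x)"
      have Gp: "?G > 0" by (rule G0[OF rp])
      have "?L x \<le> \<bar>H x\<bar> * (w (r x) * \<bar>f (\<phi> x)\<bar>)"
      proof -
        have "?L x \<le> \<bar>?L x\<bar>" by simp
        also have "\<dots> = \<bar>H x\<bar> * (w (r x) * \<bar>f (\<phi> x)\<bar>)" by (simp add: abs_mult w_def)
        finally show ?thesis .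
      qed
      also have "\<dots> \<le> \<bar>H x\<bar> * (?\<rho> (r x) powr (p - 1) * ((\<phi> x)\<^sup>2 + \<epsilon>) powr ((p - 1) / 2))"
        unfolding w_def f_def by (intro mult_left_mono regularised_power_le \<epsilon>) auto
      also have "\<dots> \<le> c / p * (\<bar>H x\<bar> / c) powr p + (p - 1) / p * c * (?G * ?T)"
        unfolding G_def T_def by (rule regularised_young[OF c p _ hardy_weight_pos[OF rp] pos(1)]) simp
      finally have L: "?L x \<le> c / p * (\<bar>H x\<bar> / c) powr p + (p - 1) / p * c * (?G * ?T)" .
      have "(f (\<phi> x))\<^sup>2 / f' (\<phi> x) \<le> ?T / (p - 1)"
        unfolding f_def f'_def T_def by (rule regularised_quotient_le[OF \<epsilon> p])
      then have "\<beta>\<^sup>2 * (?G * ((f (\<phi> x))\<^sup>2 / f' (\<phi> x))) \<le> \<beta>\<^sup>2 * (?G * (?T / (p - 1)))"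
        using Gp by (intro mult_left_mono) auto
      moreover have "(k * m (r x) + r x * m' (r x)) * F (\<phi> x) = ?A / p * ?T - \<epsilon> powr (p / 2) * ?A / p"
        by (simp add: A_def[symmetric] F_def diff_divide_distrib algebra_simps)
      ultimately have "?R x \<ge> ?A / p * ?T - \<epsilon> powr (p / 2) * ?A / p - \<beta>\<^sup>2 * (?G * (?T / (p - 1)))"
        by linarith
      moreover have "?A / p * ?T - \<beta>\<^sup>2 * (?G * (?T / (p - 1))) = (?A / p - \<beta>\<^sup>2 / (p - 1) * ?G) * ?T"
        by (simp add: algebra_simps)
      moreover have "(?A / p - \<beta>\<^sup>2 / (p - 1) * ?G) * ?T \<ge> c * ?G * ?T"
        using Abound[OF rp] by (intro mult_right_mono) (auto simp: T_def)
      ultimately have R: "?R x \<ge> c * ?G * ?T - \<epsilon> powr (p / 2) * ?A / p" by linarith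
      have "\<bar>\<phi> x\<bar> powr p = ((\<phi> x)\<^sup>2) powr (p / 2)"
      proof -
        have "(\<phi> x)\<^sup>2 = \<bar>\<phi> x\<bar> powr 2" by simp
        then show ?thesis by (simp only: powr_powr) simp
      qed
      also have "\<dots> \<le> ?T" unfolding T_def using \<epsilon> p by (intro powr_mono2) auto
      finally have "c / p * E x \<le> c / p * (?G * ?T)"
        unfolding Eeq[OF True] using Gp c p by (intro mult_left_mono) auto
      moreover have "(p - 1) / p * c * (?G * ?T) - c * ?G * ?T = - (c / p * (?G * ?T))"
        using p by (simp add: field_simps)
      moreover have "?B x = c / p * (\<bar>H x\<bar> / c) powr p - c / p * E x + \<epsilon> powr (p / 2) * ?A / p"
        using True c by (simp add: algebra_simps)
      ultimately show ?thesis using L R by linarith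
    next
      case False
      then show ?thesis by (simp add: H0 \<phi>0 f00 F00 E_def)
    qed
    have "0 \<le> (\<integral>x. ?L x - ?R x \<partial>lborel)" using en intL intR by (subst Bochner_Integration.integral_diff) auto
    also have "\<dots> \<le> (\<integral>x. ?B x \<partial>lborel)"
      by (rule integral_mono[OF _ _ pt])
         (use intL intR intH intE intA in simp_all)
    also have "\<dots> = c / p * (((\<integral>x. (\<bar>H x\<bar> / c) powr p \<partial>lborel) - (\<integral>x. E x \<partial>lborel)) + \<epsilon> powr (p / 2) / c * D)"
      unfolding D_def integral_mult_right_zero using intH intE intA by simp
    finally have "0 \<le> ((\<integral>x. (\<bar>H x\<bar> / c) powr p \<partial>lborel) - (\<integral>x. E x \<partial>lborel)) + \<epsilon> powr (p / 2) / c * D"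
      using divide_pos_pos[OF c, of p] p by (simp only: zero_le_mult_iff) linarith
    then show ?thesis by simp
  qed
  have ev0: "\<forall>\<^sub>F \<epsilon> in at_right (0::real). 0 \<le> \<epsilon>"
    by (rule eventually_mono[OF eventually_at_right_less]) simp
  have "((\<lambda>\<epsilon>. (\<integral>x. (\<bar>H x\<bar> / c) powr p \<partial>lborel) + \<epsilon> powr (p / 2) * (D / c))
     \<longlongrightarrow> (\<integral>x. (\<bar>H x\<bar> / c) powr p \<partial>lborel) + 0 powr (p / 2) * (D / c)) (at_right 0)"
    by (intro tendsto_intros tendsto_powr' disjI2 conjI ev0) (use p in auto)
  then have "(\<integral>x. E x \<partial>lborel) \<le> (\<integral>x. (\<bar>H x\<bar> / c) powr p \<partial>lborel) + 0 powr (p / 2) * (D / c)"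
    by (rule tendsto_lowerbound) (rule eventually_mono[OF eventually_at_right_less main], simp_all)
  also have "\<dots> = (\<integral>x. \<bar>H x\<bar> powr p / c powr p \<partial>lborel)"
    using c by (simp add: powr_divide)
  also have "\<dots> = (\<integral>x. \<bar>H x\<bar> powr p \<partial>lborel) / c powr p" by simp
  finally have "c powr p * (\<integral>x. E x \<partial>lborel) \<le> (\<integral>x. \<bar>H x\<bar> powr p \<partial>lborel)"
    using c by (simp add: field_simps)
  then show ?thesis by (simp add: E_def c_def H_def)
qed

end

section \<open>Lower bounds for the Hausdorff dimension\<close>

text \<open>
  A rotation that carries \<open>W\<close> to a coordinate subspace, so that volumes of neighbourhoods of translates
  of \<open>W\<close> are volumes of coordinate boxes.
\<close>

lemma orthonormal_coordinates:
  fixes W :: "'a::euclidean_space set"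
  assumes W: "subspace W"
  obtains T :: "'a \<Rightarrow> 'a" and J where "linear T" "\<forall>x. norm (T x) = norm x" "surj T" "J \<subseteq> Basis"
    "card J = dim W" "\<forall>w\<in>W. \<forall>i\<in>Basis - J. T w \<bullet> i = 0"
proof -
  obtain B1 B2 where B: "B1 \<subseteq> W" "finite B1" "finite B2" "B1 \<inter> B2 = {}" "card B1 = dim W"
      and orth: "pairwise orthogonal (B1 \<union> B2)" and norm1: "\<And>b. b \<in> B1 \<union> B2 \<Longrightarrow> norm b = 1"
      and sp: "span (B1 \<union> B2) = UNIV" and card: "card (B1 \<union> B2) = DIM('a)"
    by (rule adapted_orthonormal_basis[OF W]) blast
  have fin: "finite (B1 \<union> B2)" using B by simp
  obtain \<sigma> where \<sigma>: "bij_betw \<sigma> (Basis :: 'a set) (B1 \<union> B2)"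
    using finite_same_card_bij[OF finite_Basis fin] card by auto
  have \<sigma>in: "i \<in> Basis \<Longrightarrow> \<sigma> i \<in> B1 \<union> B2" for i using \<sigma> by (rule bij_betwE[rule_format])
  define T where "T x = (\<Sum>i\<in>Basis. (x \<bullet> \<sigma> i) *\<^sub>R i)" for x
  define J where "J = {i \<in> Basis. \<sigma> i \<in> B1}"
  have Ti: "i \<in> Basis \<Longrightarrow> T x \<bullet> i = x \<bullet> \<sigma> i" for x i
    by (simp add: T_def)
  have lin: "linear T"
    unfolding T_def[abs_def]
    by (rule linearI) (simp_all add: inner_add_left scaleR_add_left sum.distrib scaleR_sum_right)
  have expand: "(\<Sum>b\<in>B1 \<union> B2. (x \<bullet> b) *\<^sub>R b) = x" for x
    using orthonormal_basis_expand[OF orth norm1 _ fin, of x] sp by simp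
  have "norm (T x) = norm x" for x
  proof -
    have "x \<bullet> x = x \<bullet> (\<Sum>b\<in>B1 \<union> B2. (x \<bullet> b) *\<^sub>R b)" by (simp only: expand)
    also have "\<dots> = (\<Sum>b\<in>B1 \<union> B2. (x \<bullet> b) * (x \<bullet> b))" by (simp add: inner_sum_right)
    also have "\<dots> = (\<Sum>i\<in>Basis. (x \<bullet> \<sigma> i) * (x \<bullet> \<sigma> i))"
      by (rule sum.reindex_bij_betw[OF \<sigma>, symmetric])
    also have "\<dots> = T x \<bullet> T x"
      unfolding euclidean_inner[of "T x" "T x"] by (rule sum.cong) (auto simp: Ti)
    finally show ?thesis by (simp add: norm_eq_sqrt_inner)
  qed
  note norm_T = this
  have "inj T" using lin norm_T by (metis linear_injective_0 norm_eq_zero)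
  with lin have surj: "surj T" by (rule linear_injective_imp_surjective) simp
  have card: "card J = dim W"
  proof -
    have "\<sigma> ` J = B1"
      using \<sigma> unfolding J_def bij_betw_def by auto
    moreover have "inj_on \<sigma> J" using \<sigma> unfolding J_def bij_betw_def by (auto intro: inj_on_subset)
    ultimately show ?thesis using B(5) by (metis card_image)
  qed
  have perp: "T w \<bullet> i = 0" if w: "w \<in> W" and i: "i \<in> Basis - J" for w i
  proof -
    have iB: "\<sigma> i \<in> B2" "\<sigma> i \<notin> B1" using i \<sigma>in[of i] by (auto simp: J_def)
    have "independent B1"
      using norm1[of 0] pairwise_subset[OF orth] by (intro pairwise_orthogonal_independent) auto
    then have "span B1 = W"
      using card_ge_dim_independent[of B1 W] B W by (auto dest: span_minimal)
    then have "w \<in> span B1" using w by simp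
    then have "orthogonal (\<sigma> i) w"
    proof (rule orthogonal_to_span)
      fix x assume "x \<in> B1"
      then show "orthogonal (\<sigma> i) x" using orth iB unfolding pairwise_def by (metis Un_iff)
    qed
    then have "w \<bullet> \<sigma> i = 0" by (simp add: orthogonal_def inner_commute)
    then show ?thesis using i Ti[of i w] by simp
  qed
  have "J \<subseteq> Basis" by (auto simp: J_def)
  then show ?thesis using that[of T J] lin norm_T surj card perp by blast
qed

text \<open>
  A piece \<open>U\<close> of a cover of \<open>A\<close>, swept along \<open>W\<close> and cut down to the ball, lies in a box with sides
  \<open>2 diam U\<close> in the \<open>m = d - dim W\<close> directions orthogonal to \<open>W\<close> and \<open>2 \<rho>\<close> in the others. For
  \<open>s < m\<close> and \<open>diam U \<le> 1\<close> its volume is at most a constant times \<open>(diam U)\<^bsup>s\<^esup>\<close>. Arbitrarily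
  small sums of such terms would force the ball to have volume zero.
\<close>

lemma hausdorff_measure_pos:
  fixes A W :: "'a::euclidean_space set"
  assumes W: "subspace W" and rad: "\<rho> > 0"
    and ball: "ball y \<rho> \<subseteq> {a + w |a w. a \<in> A \<and> w \<in> W}"
    and s: "0 < s" "s < DIM('a) - real (dim W)"
  shows "hausdorff_measure s A \<noteq> 0"
proof
  assume zero: "hausdorff_measure s A = 0"
  have "hausdorff_pre_measure s 1 A \<le> hausdorff_measure s A"
    unfolding hausdorff_measure_def by (rule SUP_upper) simp
  then have pre: "hausdorff_pre_measure s 1 A = 0" using zero by simp
  obtain T :: "'a \<Rightarrow> 'a" and J where T: "linear T" "\<forall>x. norm (T x) = norm x" "surj T" and J: "J \<subseteq> Basis"
    "card J = dim W" "\<forall>w\<in>W. \<forall>i\<in>Basis - J. T w \<bullet> i = 0"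
    by (rule orthonormal_coordinates[OF W])
  define m where "m = card (Basis - J)"
  have fJ: "finite J" by (rule finite_subset[OF J(1) finite_Basis])
  have mcard: "real m = DIM('a) - real (dim W)"
    using card_Diff_subset[OF fJ J(1)] of_nat_diff[OF card_mono[OF finite_Basis J(1)], where ?'a = real]
    unfolding m_def J(2) by linarith
  \<comment> \<open>the volume of a box with sides \<open>2\<close> and \<open>2 \<rho>\<close>; it bounds the volume of a swept piece \<open>U\<close> by \<open>L (diam U)\<^bsup>m\<^esup>\<close>\<close>
  define L where "L = 2 ^ m * (2 * \<rho>) ^ card J"
  have L: "L > 0" using rad by (simp add: L_def)
  have Timage: "ball (T y) \<rho> \<subseteq> T ` ball y \<rho>"
  proof
    fix z assume z: "z \<in> ball (T y) \<rho>"
    obtain x where x: "z = T x" using T(3) by (metis surjD)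
    have "dist (T y) (T x) = dist y x"
      by (simp add: dist_norm T(2)[rule_format] flip: linear_diff[OF T(1)])
    then show "z \<in> T ` ball y \<rho>" using z x by auto
  qed
  have bound: "emeasure lborel (ball (T y) \<rho>) \<le> ennreal L * \<eta>" if \<eta>: "\<eta> > 0" for \<eta> :: ennreal
  proof -
    have "Inf {(\<Sum>i. ennreal (diameter (U i) powr s)) | U :: nat \<Rightarrow> 'a set.
            A \<subseteq> (\<Union>i. U i) \<and> (\<forall>i. bounded (U i) \<and> diameter (U i) \<le> 1)} < \<eta>"
      using pre \<eta> by (simp add: hausdorff_pre_measure_def)
    then obtain t where t: "t \<in> {(\<Sum>i. ennreal (diameter (U i) powr s)) | U :: nat \<Rightarrow> 'a set.
            A \<subseteq> (\<Union>i. U i) \<and> (\<forall>i. bounded (U i) \<and> diameter (U i) \<le> 1)}" "t < \<eta>"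
      unfolding Inf_less_iff by blast
    then obtain U :: "nat \<Rightarrow> 'a set" where U: "A \<subseteq> (\<Union>i. U i)" "\<And>i. bounded (U i)" "\<And>i. diameter (U i) \<le> 1"
        "(\<Sum>i. ennreal (diameter (U i) powr s)) < \<eta>"
      by blast
    define D where "D i = diameter (U i)" for i
    have D: "D i \<ge> 0" for i unfolding D_def by (rule diameter_ge_0[OF U(2)])
    \<comment> \<open>the centre is irrelevant when \<open>U i\<close> is empty, since the box then has nothing to cover\<close>
    define u where "u i = (SOME x. x \<in> U i)" for i
    define lo where "lo i = (\<Sum>b\<in>Basis. (if b \<in> J then T y \<bullet> b - \<rho> else T (u i) \<bullet> b - D i) *\<^sub>R b)" for i
    define hi where "hi i = (\<Sum>b\<in>Basis. (if b \<in> J then T y \<bullet> b + \<rho> else T (u i) \<bullet> b + D i) *\<^sub>R b)" for i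
    have cover: "ball (T y) \<rho> \<subseteq> (\<Union>i. cbox (lo i) (hi i))"
    proof
      fix z assume z: "z \<in> ball (T y) \<rho>"
      then obtain x where x: "x \<in> ball y \<rho>" "z = T x" using Timage by blast
      then obtain a w where aw: "x = a + w" "a \<in> A" "w \<in> W" using ball by blast
      then obtain i where i: "a \<in> U i" using U(1) by auto
      then have ui: "u i \<in> U i" unfolding u_def by (rule someI)
      have "z \<in> cbox (lo i) (hi i)"
        unfolding mem_box
      proof
        fix b :: 'a assume b: "b \<in> Basis"
        show "lo i \<bullet> b \<le> z \<bullet> b \<and> z \<bullet> b \<le> hi i \<bullet> b"
        proof (cases "b \<in> J")
          case True
          have "\<bar>(z - T y) \<bullet> b\<bar> \<le> norm (z - T y)" using b by (rule Basis_le_norm)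
          also have "\<dots> < \<rho>" using z by (simp add: dist_norm norm_minus_commute)
          finally show ?thesis using True b by (simp add: lo_def hi_def inner_diff_left abs_less_iff)
        next
          case False
          then have "T w \<bullet> b = 0" using J(3) aw(3) b by blast
          then have zb: "z \<bullet> b = T a \<bullet> b" by (simp add: x aw linear_add[OF T(1)] inner_add_left)
          have "\<bar>(T a - T (u i)) \<bullet> b\<bar> \<le> norm (T a - T (u i))" using b by (rule Basis_le_norm)
          also have "\<dots> = dist a (u i)" by (simp add: dist_norm T(2)[rule_format] flip: linear_diff[OF T(1)])
          also have "\<dots> \<le> D i" unfolding D_def by (rule diameter_bounded_bound[OF U(2) i ui])
          finally show ?thesis using False b zb by (simp add: lo_def hi_def inner_diff_left abs_le_iff)
        qed
      qed
      then show "z \<in> (\<Union>i. cbox (lo i) (hi i))" by blast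
    qed
    have vol: "emeasure lborel (cbox (lo i) (hi i)) \<le> ennreal L * ennreal (D i powr s)" for i
    proof -
      have "emeasure lborel (cbox (lo i) (hi i)) = ennreal (\<Prod>b\<in>Basis. (hi i - lo i) \<bullet> b)"
        using D[of i] rad by (subst emeasure_lborel_cbox) (auto simp: lo_def hi_def)
      also have "(\<Prod>b\<in>Basis. (hi i - lo i) \<bullet> b) = (\<Prod>b\<in>Basis. if b \<in> J then 2 * \<rho> else 2 * D i)"
        by (rule prod.cong) (auto simp: lo_def hi_def inner_diff_left)
      also have "\<dots> = (2 * \<rho>) ^ card J * (2 * D i) ^ m"
      proof -
        have "Basis \<inter> {b. b \<in> J} = J" "Basis \<inter> - {b. b \<in> J} = Basis - J" using J(1) by auto
        then show ?thesis by (simp add: prod.If_cases m_def)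
      qed
      also have "\<dots> = L * D i ^ m" by (simp add: L_def power_mult_distrib)
      also have "\<dots> \<le> L * (D i powr s)"
      proof (rule mult_left_mono)
        show "D i ^ m \<le> D i powr s"
        proof (cases "D i = 0")
          case True
          then show ?thesis using s mcard by (cases m) auto
        next
          case False
          then have Dp: "D i > 0" using D[of i] by simp
          have "D i ^ m = D i powr real m" using Dp by (simp add: powr_realpow)
          also have "\<dots> \<le> D i powr s"
            using Dp U(3)[of i] s mcard by (intro powr_mono') (auto simp: D_def)
          finally show ?thesis .
        qed
      qed (use L in simp)
      finally have "emeasure lborel (cbox (lo i) (hi i)) \<le> ennreal (L * (D i powr s))"
        by (simp add: ennreal_leI)
      then show ?thesis using L by (simp add: ennreal_mult)
    qed
    have "emeasure lborel (ball (T y) \<rho>) \<le> emeasure lborel (\<Union>i. cbox (lo i) (hi i))"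
      by (intro emeasure_mono cover) auto
    also have "\<dots> \<le> (\<Sum>i. emeasure lborel (cbox (lo i) (hi i)))"
      by (rule emeasure_subadditive_countably) auto
    also have "\<dots> \<le> (\<Sum>i. ennreal L * ennreal (D i powr s))"
      by (intro suminf_le vol) auto
    also have "\<dots> = ennreal L * (\<Sum>i. ennreal (D i powr s))" by simp
    also have "\<dots> \<le> ennreal L * \<eta>" using U(4) unfolding D_def by (intro mult_left_mono) auto
    finally show ?thesis .
  qed
  have "emeasure lborel (ball (T y) \<rho>) \<le> ennreal \<epsilon>" if "\<epsilon> > 0" for \<epsilon>
  proof -
    have "ennreal L * ennreal (\<epsilon> / L) = ennreal \<epsilon>"
      using L that by (subst ennreal_mult[symmetric]) auto
    then show ?thesis using bound[of "ennreal (\<epsilon> / L)"] L that by simp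
  qed
  then have "emeasure lborel (ball (T y) \<rho>) \<le> 0"
    by - (rule ennreal_le_epsilon, simp)
  moreover have "emeasure lborel (ball (T y) \<rho>) \<noteq> 0"
    using rad unit_ball_vol_pos[of "real DIM('a)"] by (simp add: emeasure_ball less_imp_neq[symmetric])
  ultimately show False by simp
qed

text \<open>
  Cutting the cube of side \<open>2 R\<close> into \<open>N\<^bsup>d\<^esup>\<close> equal cubes of diameter at most \<open>B / N\<close> gives a sum of at most
  \<open>N\<^bsup>d\<^esup> (B / N)\<^bsup>d+1\<^esup> = B\<^bsup>d+1\<^esup> / N\<close>.
\<close>

lemma cube_cover_small_sum:
  fixes R \<epsilon> \<eta> :: real
  assumes "R > 0" "\<epsilon> > 0" "\<eta> > 0"
  obtains V :: "nat \<Rightarrow> 'a::euclidean_space set" where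
    "\<forall>x. (\<forall>i\<in>Basis. - R \<le> x \<bullet> i \<and> x \<bullet> i < R) \<longrightarrow> x \<in> (\<Union>j. V j)"
    "\<forall>j. bounded (V j) \<and> diameter (V j) \<le> \<epsilon>"
    "(\<Sum>j. ennreal (diameter (V j) powr (real DIM('a) + 1))) \<le> ennreal \<eta>"
proof -
  let ?n = "DIM('a)"
  define B where "B = 2 * real ?n * R"
  have B: "B > 0" using assms by (simp add: B_def)
  obtain N0 :: nat where N0: "max (B / \<epsilon>) (B ^ (?n + 1) / \<eta>) < real N0"
    using reals_Archimedean2 by blast
  define N where "N = max 1 N0"
  have N: "N \<ge> 1" "B / \<epsilon> \<le> real N" "B ^ (?n + 1) / \<eta> \<le> real N" using N0 by (auto simp: N_def)
  define h where "h = 2 * R / real N"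
  have h: "h > 0" using assms N by (simp add: h_def)
  define I where "I = (PiE (Basis :: 'a set) (\<lambda>_. {..<N}))"
  have finI: "finite I" and cardI: "card I = N ^ ?n"
    by (auto simp: I_def card_PiE intro!: finite_PiE)
  define Q where "Q f = cbox (\<Sum>i\<in>Basis. (- R + real (f i) * h) *\<^sub>R i) (\<Sum>i\<in>Basis. (- R + real (f i) * h + h) *\<^sub>R i)"
    for f :: "'a \<Rightarrow> nat"
  have diamQ: "diameter (Q f) \<le> B / N" for f :: "'a \<Rightarrow> nat"
  proof -
    let ?a = "\<Sum>i\<in>(Basis::'a set). (- R + real (f i) * h) *\<^sub>R i"
    let ?b = "\<Sum>i\<in>(Basis::'a set). (- R + real (f i) * h + h) *\<^sub>R i"
    have "diameter (Q f) = norm (?a - ?b)"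
      unfolding Q_def dist_norm[symmetric] by (rule diameter_cbox) (use h in simp)
    also have "\<dots> \<le> (\<Sum>i\<in>Basis. \<bar>(?a - ?b) \<bullet> i\<bar>)" by (rule norm_le_l1)
    also have "\<dots> = (\<Sum>i\<in>(Basis::'a set). h)"
      by (rule sum.cong) (use h in \<open>auto simp: inner_diff_left\<close>)
    also have "\<dots> = B / N" by (simp add: B_def h_def)
    finally show ?thesis .
  qed
  obtain e where e: "bij_betw e {0..<card I} I"
    using ex_bij_betw_nat_finite[OF finI] by blast
  define V where "V j = (if j < card I then Q (e j) else {})" for j
  have "x \<in> (\<Union>j. V j)" if x: "\<forall>i\<in>Basis. - R \<le> x \<bullet> i \<and> x \<bullet> i < R" for x
  proof -
    define f where "f = restrict (\<lambda>i. nat \<lfloor>(x \<bullet> i + R) / h\<rfloor>) Basis"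
    have fi: "real (f i) \<le> (x \<bullet> i + R) / h" "(x \<bullet> i + R) / h < real (f i) + 1" "f i < N" if i: "i \<in> Basis" for i
    proof -
      have nn: "(x \<bullet> i + R) / h \<ge> 0" using x i h by fastforce
      then have eq: "real (f i) = of_int \<lfloor>(x \<bullet> i + R) / h\<rfloor>" using i by (simp add: f_def)
      show 1: "real (f i) \<le> (x \<bullet> i + R) / h" "(x \<bullet> i + R) / h < real (f i) + 1"
        unfolding eq by linarith+
      have "(x \<bullet> i + R) / h < 2 * R / h" using x i h by (intro divide_strict_right_mono) fastforce+
      also have "2 * R / h = N" using assms N by (simp add: h_def)
      finally show "f i < N" using 1 by linarith
    qed
    have "f \<in> I" unfolding I_def using fi(3) by (auto simp: f_def)
    then obtain j where j: "j < card I" "e j = f" using e unfolding bij_betw_def by force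
    have "x \<in> Q f"
      unfolding Q_def mem_box
    proof
      fix i :: 'a assume i: "i \<in> Basis"
      have "real (f i) * h \<le> x \<bullet> i + R" "x \<bullet> i + R \<le> (real (f i) + 1) * h"
        using fi(1,2)[OF i] h by (simp_all add: pos_le_divide_eq pos_divide_less_eq less_imp_le)
      then show "(\<Sum>i\<in>Basis. (- R + real (f i) * h) *\<^sub>R i) \<bullet> i \<le> x \<bullet> i \<and>
          x \<bullet> i \<le> (\<Sum>i\<in>Basis. (- R + real (f i) * h + h) *\<^sub>R i) \<bullet> i"
        using i by (simp only: inner_sum_left_Basis) (simp add: algebra_simps)
    qed
    then show ?thesis using j by (auto simp: V_def)
  qed
  moreover have "bounded (V j) \<and> diameter (V j) \<le> \<epsilon>" for j
  proof -
    have "B / N \<le> \<epsilon>" using N assms by (simp add: field_simps)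
    then show ?thesis using diamQ[of "e j"] assms by (auto simp: V_def Q_def)
  qed
  moreover have "(\<Sum>j. ennreal (diameter (V j) powr (real ?n + 1))) \<le> ennreal \<eta>"
  proof -
    have "(\<Sum>j. ennreal (diameter (V j) powr (real ?n + 1))) = (\<Sum>j<card I. ennreal (diameter (V j) powr (real ?n + 1)))"
      by (rule suminf_finite) (auto simp: V_def)
    also have "\<dots> \<le> (\<Sum>j<card I. ennreal ((B / N) ^ (?n + 1)))"
    proof (rule sum_mono, rule ennreal_leI)
      fix j assume "j \<in> {..<card I}"
      then have "diameter (V j) \<le> B / N" "diameter (V j) \<ge> 0"
        using diamQ[of "e j"] by (auto simp: V_def Q_def intro!: diameter_ge_0)
      then have "diameter (V j) powr (real ?n + 1) \<le> (B / N) powr (real ?n + 1)"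
        by (intro powr_mono2) auto
      also have "\<dots> = (B / N) ^ (?n + 1)"
        using B N powr_realpow[of "B / N" "?n + 1"] by (simp add: add.commute)
      finally show "diameter (V j) powr (real ?n + 1) \<le> (B / N) ^ (?n + 1)" .
    qed
    also have "\<dots> = ennreal (real N ^ ?n * (B / N) ^ (?n + 1))"
      using B by (subst ennreal_mult) (auto simp del: power_Suc simp: cardI ennreal_of_nat_eq_real_of_nat)
    also have "real N ^ ?n * (B / N) ^ (?n + 1) = B ^ (?n + 1) / N"
      using N by (simp add: power_divide)
    also have "ennreal (B ^ (?n + 1) / N) \<le> ennreal \<eta>"
      using N assms by (intro ennreal_leI) (simp add: field_simps)
    finally show ?thesis .
  qed
  ultimately show ?thesis using that[of V] by blast
qed

text \<open>
  This makes the set whose infimum is the Hausdorff dimension non-empty. The space is exhausted by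
  cubes, and the \<open>n\<close>-th cube is covered with total cost \<open>\<eta> / 2\<^bsup>n+1\<^esup>\<close>.
\<close>

lemma hausdorff_measure_above_dimension:
  "hausdorff_measure (real DIM('a) + 1) (A :: 'a::euclidean_space set) = 0"
proof -
  let ?s = "real DIM('a) + 1"
  have "hausdorff_pre_measure ?s \<epsilon> A \<le> 0 + ennreal \<eta>" if "\<epsilon> > 0" "\<eta> > 0" for \<epsilon> \<eta>
  proof -
    have "\<exists>V :: nat \<Rightarrow> 'a set. (\<forall>x. (\<forall>i\<in>Basis. - real (Suc n) \<le> x \<bullet> i \<and> x \<bullet> i < real (Suc n)) \<longrightarrow> x \<in> (\<Union>j. V j)) \<and>
       (\<forall>j. bounded (V j) \<and> diameter (V j) \<le> \<epsilon>) \<and>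
       (\<Sum>j. ennreal (diameter (V j) powr ?s)) \<le> ennreal (\<eta> * (1 / 2) ^ Suc n)" for n
      by (rule cube_cover_small_sum[of "real (Suc n)" \<epsilon> "\<eta> * (1 / 2) ^ Suc n"]) (use that in auto)
    then obtain V :: "nat \<Rightarrow> nat \<Rightarrow> 'a set" where
      V1: "\<And>n x. (\<forall>i\<in>Basis. - real (Suc n) \<le> x \<bullet> i \<and> x \<bullet> i < real (Suc n)) \<Longrightarrow> x \<in> (\<Union>j. V n j)" and
      V2: "\<And>n j. bounded (V n j)" "\<And>n j. diameter (V n j) \<le> \<epsilon>" and
      V3: "\<And>n. (\<Sum>j. ennreal (diameter (V n j) powr ?s)) \<le> ennreal (\<eta> * (1 / 2) ^ Suc n)"
      by metis
    define U where "U i = case_prod V (prod_decode i)" for i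
    have cov: "A \<subseteq> (\<Union>i. U i)"
    proof
      fix x assume "x \<in> A"
      obtain n :: nat where n: "norm x < real n" using reals_Archimedean2 by blast
      have "- real (Suc n) \<le> x \<bullet> i \<and> x \<bullet> i < real (Suc n)" if "i \<in> Basis" for i
        using Basis_le_norm[OF that, of x] n by (simp add: abs_le_iff)
      then obtain j where "x \<in> V n j" using V1[of n x] by blast
      then have "x \<in> U (prod_encode (n, j))" by (simp add: U_def)
      then show "x \<in> (\<Union>i. U i)" by blast
    qed
    have "(\<Sum>i. ennreal (diameter (U i) powr ?s))
        = (\<Sum>i. (\<lambda>(n, j). ennreal (diameter (V n j) powr ?s)) (prod_decode i))"
      by (simp add: U_def case_prod_beta)
    also have "\<dots> = (\<Sum>n. \<Sum>j. ennreal (diameter (V n j) powr ?s))"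
      by (rule suminf_ennreal_2dimen) simp
    also have "\<dots> \<le> (\<Sum>n. ennreal (\<eta> * (1 / 2) ^ Suc n))"
      by (intro suminf_le V3) auto
    also have "\<dots> = ennreal \<eta>"
    proof -
      have "(\<lambda>n. \<eta> * (1 / 2) ^ Suc n) sums (\<eta> * 1)" by (intro sums_mult power_half_series)
      then show ?thesis using that by (intro suminf_ennreal_eq) auto
    qed
    finally have sum: "(\<Sum>i. ennreal (diameter (U i) powr ?s)) \<le> ennreal \<eta>" .
    have "hausdorff_pre_measure ?s \<epsilon> A \<le> (\<Sum>i. ennreal (diameter (U i) powr ?s))"
      unfolding hausdorff_pre_measure_def
      by (rule Inf_lower) (use cov V2 in \<open>auto simp: U_def case_prod_beta\<close>)
    then show ?thesis using sum by simp
  qed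
  then have "hausdorff_pre_measure ?s \<epsilon> A \<le> 0" if "\<epsilon> > 0" for \<epsilon>
    by (rule ennreal_le_epsilon) (use that in auto)
  then show ?thesis unfolding hausdorff_measure_def by (intro SUP_eq_const[of _ _ 0, simplified]) auto
qed

lemma hausdorff_dim_ge:
  fixes A W :: "'a::euclidean_space set"
  assumes "subspace W" "\<rho> > 0" "ball y \<rho> \<subseteq> {a + w |a w. a \<in> A \<and> w \<in> W}"
  shows "hausdorff_dim A \<ge> DIM('a) - real (dim W)"
  unfolding hausdorff_dim_def
proof (rule cInf_greatest)
  have "real DIM('a) + 1 \<in> {s. 0 < s \<and> hausdorff_measure s A = 0}"
    using hausdorff_measure_above_dimension[of A] by simp
  then show "{s. 0 < s \<and> hausdorff_measure s A = 0} \<noteq> {}" by blast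
  show "DIM('a) - real (dim W) \<le> s" if "s \<in> {s. 0 < s \<and> hausdorff_measure s A = 0}" for s
    using hausdorff_measure_pos[OF assms, of s] that by force
qed

section \<open>The codimension of the frontier\<close>

context closed_convex
begin

text \<open>
  If \<open>K\<close> has no interior, it is its own frontier and has interior relative to its affine hull, so adding
  the orthogonal complement \<open>W\<close> of the direction space of \<open>K\<close> fills a ball; the divergence is at least
  \<open>dim W\<close>. If \<open>K\<close> has an interior point \<open>a\<close>, fix a point \<open>b\<close> outside \<open>K\<close>: every segment parallel to
  \<open>b - a\<close> that starts near \<open>a\<close> crosses the frontier, so adding the line spanned by \<open>b - a\<close> fills a ball;
  the divergence is at least \<open>1\<close>.
\<close>

lemma divergence_ge_codimension_of_frontier:
  assumes KU: "K \<noteq> UNIV" and f: "C1c S \<zeta> h" and S: "S \<subseteq> - K" and nn: "\<And>x. \<zeta> x \<ge> 0"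
  shows "- (\<integral>x. X x \<bullet> h x \<partial>lborel) \<ge> (DIM('a) - hausdorff_dim (frontier K)) * (\<integral>x. \<zeta> x \<partial>lborel)"
proof -
  have int0: "(\<integral>x. \<zeta> x \<partial>lborel) \<ge> 0" using nn by simp
  show ?thesis
  proof (cases "interior K = {}")
    case True
    then have fr: "frontier K = K" using cl by (simp add: frontier_def)
    obtain a where "a \<in> rel_interior K" using ne cv rel_interior_eq_empty by blast
    then obtain e where a: "a \<in> K" "e > 0" "ball a e \<inter> affine hull K \<subseteq> K"
      using mem_rel_interior_ball by blast
    define V where "V = span ((\<lambda>x. - a + x) ` K)"
    define W where "W = {y. \<forall>x\<in>V. orthogonal x y}"
    have W: "subspace W" unfolding W_def by (rule subspace_orthogonal_to_vectors)
    have inV: "x - a \<in> V" if "x \<in> K" for x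
      unfolding V_def using that by (intro span_base) auto
    have hull: "affine hull K = (\<lambda>x. a + x) ` V"
      unfolding V_def using a(1) by (intro affine_hull_span_gen hull_inc)
    have perp: "(x - y) \<bullet> w = 0" if "x \<in> K" "y \<in> K" "w \<in> W" for x y w
    proof -
      have "(x - a) \<bullet> w = 0" "(y - a) \<bullet> w = 0"
        using inV that unfolding W_def orthogonal_def by blast+
      then show ?thesis by (simp add: inner_diff_left)
    qed
    have "ball a e \<subseteq> {x + w |x w. x \<in> frontier K \<and> w \<in> W}"
    proof
      fix y assume y: "y \<in> ball a e"
      obtain v z where vz: "v \<in> span V" "\<And>w. w \<in> span V \<Longrightarrow> orthogonal z w" "y - a = v + z"
        using orthogonal_subspace_decomp_exists[of V "y - a"] by blast
      have v: "v \<in> V" using vz(1) by (simp add: V_def span_span)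
      have z: "z \<in> W" unfolding W_def using vz(2)[OF span_base] orthogonal_commute by blast
      have "(norm (y - a))\<^sup>2 = (norm v)\<^sup>2 + (norm z)\<^sup>2"
        unfolding vz(3) using vz(2)[OF vz(1)] orthogonal_commute by (intro norm_add_Pythagorean) blast
      then have "norm v \<le> norm (y - a)" by - (rule power2_le_imp_le, auto)
      then have "a + v \<in> ball a e" using y by (simp add: dist_norm norm_minus_commute)
      then have "a + v \<in> K" using a(3) v hull by blast
      moreover have "y = (a + v) + z" using vz(3) by (simp add: algebra_simps)
      ultimately show "y \<in> {x + w |x w. x \<in> frontier K \<and> w \<in> W}" using z fr by blast
    qed
    then have "hausdorff_dim (frontier K) \<ge> DIM('a) - real (dim W)"
      by (rule hausdorff_dim_ge[OF W a(2)])
    then have "(DIM('a) - hausdorff_dim (frontier K)) * (\<integral>x. \<zeta> x \<partial>lborel) \<le> real (dim W) * (\<integral>x. \<zeta> x \<partial>lborel)"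
      using int0 by (intro mult_right_mono) auto
    also have "\<dots> \<le> - (\<integral>x. X x \<bullet> h x \<partial>lborel)"
      by (rule divergence_ge_codim[OF W perp f nn])
    finally show ?thesis .
  next
    case False
    then obtain a where "a \<in> interior K" by blast
    then obtain e where e: "e > 0" "ball a e \<subseteq> K" using mem_interior by blast
    obtain b where b: "b \<in> - K" using KU by blast
    then obtain e' where e': "e' > 0" "ball b e' \<subseteq> - K"
      using open_compl open_contains_ball by blast
    define \<rho> where "\<rho> = min e e'"
    have \<rho>: "\<rho> > 0" using e e' by (simp add: \<rho>_def)
    define W where "W = span {b - a}"
    have "dim W \<le> 1" unfolding W_def using dim_le_card[of "{b - a}" "{b - a}"] by (simp add: dim_span)
    have "ball a \<rho> \<subseteq> {x + w |x w. x \<in> frontier K \<and> w \<in> W}"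
    proof
      fix y assume y: "y \<in> ball a \<rho>"
      have yK: "y \<in> K" using y e by (auto simp: \<rho>_def)
      have "y + (b - a) \<in> ball b e'" using y by (simp add: \<rho>_def dist_norm algebra_simps)
      then have y'K: "y + (b - a) \<notin> K" using e' by blast
      have "closed_segment y (y + (b - a)) \<inter> frontier K \<noteq> {}"
        by (rule connected_Int_frontier) (use yK y'K in auto)
      then obtain x where x: "x \<in> closed_segment y (y + (b - a))" "x \<in> frontier K" by blast
      then obtain t where t: "x = y + t *\<^sub>R (b - a)"
        unfolding closed_segment_def by (auto simp: algebra_simps)
      then have "y = x + (- t) *\<^sub>R (b - a)" by simp
      moreover have "(- t) *\<^sub>R (b - a) \<in> W" unfolding W_def by (intro span_mul span_base) simp
      ultimately show "y \<in> {x + w |x w. x \<in> frontier K \<and> w \<in> W}" using x by blast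
    qed
    then have "hausdorff_dim (frontier K) \<ge> DIM('a) - real (dim W)"
      by (rule hausdorff_dim_ge[OF _ \<rho>, rotated]) (simp add: W_def)
    then have "(DIM('a) - hausdorff_dim (frontier K)) * (\<integral>x. \<zeta> x \<partial>lborel) \<le> 1 * (\<integral>x. \<zeta> x \<partial>lborel)"
      using int0 \<open>dim W \<le> 1\<close> by (intro mult_right_mono) auto
    also have "\<dots> \<le> - (\<integral>x. X x \<bullet> h x \<partial>lborel)"
      using divergence_ge_1[OF f S nn] by simp
    finally show ?thesis .
  qed
qed

end

section \<open>Functions on \<open>\<real>\<^sup>n\<close> given by partial derivatives\<close>

lemma partial_eq_derivative:
  assumes "(f has_derivative D) (at x)"
  shows "partial k f x = D (axis k 1)"
proof -
  have "((\<lambda>t. f (x + t *\<^sub>R axis k 1)) has_derivative (\<lambda>t. D (t *\<^sub>R axis k 1))) (at 0)"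
    by (rule has_derivative_compose[of "\<lambda>t. x + t *\<^sub>R axis k 1"])
       (auto intro!: derivative_eq_intros assms)
  then have "((\<lambda>t. f (x + t *\<^sub>R axis k 1)) has_real_derivative D (axis k 1)) (at 0)"
    unfolding has_field_derivative_def
    by (rule has_derivative_eq_rhs)
       (simp add: fun_eq_iff linear_scale[OF has_derivative_linear[OF assms]] mult.commute)
  then show ?thesis unfolding partial_def by (rule DERIV_imp_deriv)
qed

definition gradient :: "(real ^ 'n::finite \<Rightarrow> real) \<Rightarrow> real ^ 'n \<Rightarrow> real ^ 'n" where
  "gradient f x = (\<chi> k. partial k f x)"

lemma gradient_inner_axis: "gradient f x \<bullet> axis k 1 = partial k f x"
  by (simp add: gradient_def inner_axis)

lemma has_derivative_gradient:
  assumes "f differentiable (at x)"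
  shows "(f has_derivative (\<lambda>v. gradient f x \<bullet> v)) (at x)"
proof -
  obtain D where D: "(f has_derivative D) (at x)" using assms by (auto simp: differentiable_def)
  have lin: "linear D" using has_derivative_linear[OF D] .
  have "D v = gradient f x \<bullet> v" for v
  proof -
    have "D v = D (\<Sum>k\<in>UNIV. (v $ k) *\<^sub>R axis k 1)" by (simp add: basis_expansion flip: scalar_mult_eq_scaleR)
    also have "\<dots> = (\<Sum>k\<in>UNIV. (v $ k) * partial k f x)"
      by (simp add: linear_sum[OF lin] linear_scale[OF lin] partial_eq_derivative[OF D])
    finally show ?thesis by (simp add: gradient_def inner_vec_def mult.commute)
  qed
  then show ?thesis using D by (metis (no_types, lifting) ext)
qed

text \<open>
  Off \<open>S\<close> the function vanishes on an open set, and this set and \<open>\<Omega>\<close> cover the space. The lemma passes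
  from regularity on \<open>\<Omega>\<close> to regularity of the extension by zero.
\<close>

lemma C1c_gradient:
  fixes f :: "real ^ 'n::finite \<Rightarrow> real"
  assumes f: "C1_on \<Omega> f" and S: "compact S" "S \<subseteq> \<Omega>" and "open \<Omega>" and z: "\<And>x. x \<notin> S \<Longrightarrow> f x = 0"
  shows "C1c S f (gradient f)"
proof -
  have opS: "open (- S)" using S by (simp add: compact_imp_closed open_Compl)
  have un: "\<Omega> \<union> - S = UNIV" using S by auto
  have off: "(f has_derivative (\<lambda>v. 0)) (at x)" if "x \<in> - S" for x
    by (rule has_derivative_transform_within_open[OF has_derivative_const[of 0] opS that]) (simp add: z)
  have goff: "gradient f x = 0" if "x \<in> - S" for x
    using partial_eq_derivative[OF off[OF that]] by (simp add: gradient_def vec_eq_iff)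
  have "(f has_derivative (\<lambda>v. gradient f x \<bullet> v)) (at x)" for x
  proof (cases "x \<in> \<Omega>")
    case True
    then show ?thesis using f unfolding C1_on_def by (intro has_derivative_gradient) auto
  next
    case False
    then have x: "x \<in> - S" using S by auto
    show ?thesis using off[OF x] by (simp add: goff[OF x])
  qed
  moreover have "continuous_on (\<Omega> \<union> - S) (gradient f)"
  proof (rule continuous_on_open_Un[OF \<open>open \<Omega>\<close> opS])
    show "continuous_on \<Omega> (gradient f)"
      using f unfolding C1_on_def gradient_def[abs_def] by (intro continuous_on_vec_lambda) auto
    show "continuous_on (- S) (gradient f)"
      by (rule continuous_on_eq[of _ "\<lambda>x. 0"]) (auto simp: goff)
  qed
  ultimately show ?thesis using S z unfolding C1c_def un by auto
qed

lemma sum_Basis_axis: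
  fixes F :: "real ^ 'n::finite \<Rightarrow> real"
  shows "(\<Sum>e\<in>Basis. F e) = (\<Sum>k\<in>UNIV. F (axis k 1))"
proof -
  have B: "(Basis :: (real ^ 'n) set) = range (\<lambda>k. axis k 1)" by (auto simp: Basis_vec_def)
  have "inj (\<lambda>k::'n. axis k (1::real))" by (auto simp: inj_on_def axis_eq_axis)
  then show ?thesis unfolding B by (subst sum.reindex) (auto simp: o_def)
qed

theorem theorem1p2:
  fixes K \<Omega> :: "(real ^ 'n::finite) set"
    and d d\<^sub>H \<delta> \<delta>' p C :: real
    and d\<^sub>\<Gamma> c\<^sub>\<Omega> :: "real ^ 'n \<Rightarrow> real"
    and H :: "(real ^ 'n \<Rightarrow> real) \<Rightarrow> real ^ 'n \<Rightarrow> real"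
  assumes "K \<noteq> {}" and "closed K" and "convex K" and "K \<noteq> UNIV"
    and "\<Omega> = UNIV - K"
    and "d = real CARD('n)"
    and "d\<^sub>H = hausdorff_dim (frontier \<Omega>)"
    and "d\<^sub>\<Gamma> = bdry_dist \<Omega>"
    and "0 \<le> \<delta>" and "\<delta> < 2" and "0 \<le> \<delta>'" and "\<delta>' < 2"
    and "c\<^sub>\<Omega> = weight \<delta> \<delta>' \<circ> d\<^sub>\<Gamma>"
    and "H = div_form_op c\<^sub>\<Omega>"
    and "1 < p"
    and "d - d\<^sub>H + p * min \<delta> \<delta>' - 2 * p \<ge> 2 * p * \<bar>\<delta> - \<delta>'\<bar> / (2 - max \<delta> \<delta>')"
    and "C = (p - 1) * (d - d\<^sub>H) * (d - d\<^sub>H + p * min \<delta> \<delta>' - 2 * p) / p\<^sup>2"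
  shows "\<exists>c. 0 \<le> c \<and> c \<le> C \<and> (0 < C \<longrightarrow> 0 < c) \<and> (\<delta> = \<delta>' \<longrightarrow> c = C) \<and>
           (\<forall>\<phi>\<in>Cc2 \<Omega>.
              (LINT x:\<Omega>|lborel. \<bar>H \<phi> x\<bar> powr p)
                \<ge> c powr p * (LINT x:\<Omega>|lborel. \<bar>c\<^sub>\<Omega> x * \<phi> x / (d\<^sub>\<Gamma> x)\<^sup>2\<bar> powr p))"
proof -
  interpret closed_convex K by unfold_locales (use assms in auto)
  define k where "k = d - d\<^sub>H"
  define b where "b = k + p * min \<delta> \<delta>' - 2 * p"
  define c where "c = rellich_const k p \<delta> \<delta>'"
  have \<Omega>: "\<Omega> = - K" using assms(5) by auto
  have p: "p > 1" and del: "\<delta> < 2" "\<delta>' < 2" using assms by auto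
  have cond: "k + p * min \<delta> \<delta>' - 2 * p \<ge> 2 * p * \<bar>\<delta> - \<delta>'\<bar> / (2 - max \<delta> \<delta>')"
    using assms(16) by (simp add: k_def)
  have rhs0: "2 * p * \<bar>\<delta> - \<delta>'\<bar> / (2 - max \<delta> \<delta>') \<ge> 0" using p del by (intro divide_nonneg_nonneg) auto
  have b0: "b \<ge> 0" using cond rhs0 by (simp add: b_def)
  \<comment> \<open>with \<open>b \<ge> 0\<close> this gives \<open>k \<ge> 0\<close> as well as \<open>c \<le> C\<close>\<close>
  have bk: "b \<le> k"
  proof -
    have "p * min \<delta> \<delta>' \<le> p * 2" using p del by (intro mult_left_mono) auto
    then show ?thesis by (simp add: b_def)
  qed
  have Ceq: "C = (p - 1) * k * b / p\<^sup>2" using assms(17) by (simp add: k_def b_def)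
  have ceq: "c = (p - 1) * (if \<delta> = \<delta>' then k else b) * b / p\<^sup>2"
    by (simp add: c_def rellich_const_def b_def Let_def)
  have c0: "0 \<le> c" unfolding ceq using p b0 bk by (auto intro!: divide_nonneg_nonneg)
  have cC: "c \<le> C" unfolding ceq Ceq using p b0 bk
    by (intro divide_right_mono mult_right_mono mult_left_mono) auto
  have cpos: "0 < c" if "0 < C"
  proof -
    have "b \<noteq> 0" using that by (auto simp: Ceq)
    then have "0 < b" "0 < k" using b0 bk by auto
    then show ?thesis unfolding ceq using p by (auto intro!: divide_pos_pos)
  qed
  have "(LINT x:\<Omega>|lborel. \<bar>H \<phi> x\<bar> powr p) \<ge> c powr p * (LINT x:\<Omega>|lborel. \<bar>c\<^sub>\<Omega> x * \<phi> x / (d\<^sub>\<Gamma> x)\<^sup>2\<bar> powr p)"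
    if \<phi>in: "\<phi> \<in> Cc2 \<Omega>" for \<phi>
  proof (cases "c = 0")
    case True
    have "(LINT x:\<Omega>|lborel. \<bar>H \<phi> x\<bar> powr p) \<ge> 0" unfolding set_lebesgue_integral_def by simp
    then show ?thesis using True by simp
  next
    case False
    then have cp: "rellich_const k p \<delta> \<delta>' > 0" using c0 by (simp add: c_def)
    define S where "S = closure {x. \<phi> x \<noteq> 0}"
    have S: "compact S" "S \<subseteq> - K" and C2: "C2_on \<Omega> \<phi>"
      using \<phi>in by (auto simp: Cc2_def S_def \<Omega>)
    have \<phi>0: "x \<notin> S \<Longrightarrow> \<phi> x = 0" for x
      unfolding S_def using closure_subset[of "{x. \<phi> x \<noteq> 0}"] by auto
    have op: "open \<Omega>" using open_compl \<Omega> by simp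
    have S\<Omega>: "S \<subseteq> \<Omega>" using S \<Omega> by simp
    have \<phi>: "C1c S \<phi> (gradient \<phi>)"
      using C2 unfolding C2_on_def by (intro C1c_gradient[OF _ S(1) S\<Omega> op \<phi>0]) auto
    have p\<phi>: "C1c S (partial j \<phi>) (gradient (partial j \<phi>))" for j
    proof (rule C1c_gradient[OF _ S(1) S\<Omega> op])
      show "C1_on \<Omega> (partial j \<phi>)" using C2 unfolding C2_on_def by auto
      show "partial j \<phi> x = 0" if "x \<notin> S" for x
        using C1c_gradient_eq_0[OF \<phi> that] by (simp flip: gradient_inner_axis)
    qed
    \<comment> \<open>the components of the flux \<open>c\<^sub>\<Omega> \<nabla>\<phi>\<close>, which are \<open>C\<^sup>1\<close> because \<open>r\<close> is \<open>C\<^sup>1\<close> off \<open>K\<close>\<close>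
    define u where "u e x = weight \<delta> \<delta>' (r x) * (gradient \<phi> x \<bullet> e)" for e x
    define v where "v e = gradient (u e)" for e
    have dG: "d\<^sub>\<Gamma> x = r x" for x unfolding assms(5,8) bdry_dist_def by (simp add: double_diff)
    have cO: "c\<^sub>\<Omega> x = weight \<delta> \<delta>' (r x)" for x using assms(13) dG by simp
    have flux: "C1c S (u e) (v e)" if e: "e \<in> Basis" for e
    proof -
      obtain j where j: "e = axis j 1" using e by (auto simp: Basis_vec_def)
      have ue: "u e = (\<lambda>x. weight \<delta> \<delta>' (r x) * partial j \<phi> x)"
        unfolding u_def j gradient_inner_axis ..
      have "C1c S (u e) (\<lambda>x. weight \<delta> \<delta>' (r x) *\<^sub>R gradient (partial j \<phi>) x
          + partial j \<phi> x *\<^sub>R ((weight \<delta> \<delta>' (r x) * weight_exponent \<delta> \<delta>' (r x) / r x) *\<^sub>R N x))"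
        unfolding ue
      proof (rule C1c_radial_mult[OF p\<phi> S(2)])
        show "(weight \<delta> \<delta>' has_real_derivative weight \<delta> \<delta>' s * weight_exponent \<delta> \<delta>' s / s) (at s)"
          if "s > 0" for s by (rule DERIV_weight[OF that])
        have "continuous_on {0<..} (weight \<delta> \<delta>')"
          using DERIV_weight by (meson DERIV_isCont continuous_at_imp_continuous_on greaterThan_iff)
        then show "continuous_on {0<..} (\<lambda>s. weight \<delta> \<delta>' s * weight_exponent \<delta> \<delta>' s / s)"
          by (rule continuous_on_divide[OF continuous_on_mult[OF _ continuous_weight_exponent] continuous_on_id]) simp
      qed
      note D = C1cD(3)[OF this]
      have "gradient (u e) = (\<lambda>x. weight \<delta> \<delta>' (r x) *\<^sub>R gradient (partial j \<phi>) x
          + partial j \<phi> x *\<^sub>R ((weight \<delta> \<delta>' (r x) * weight_exponent \<delta> \<delta>' (r x) / r x) *\<^sub>R N x))"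
        unfolding gradient_def[of "u e"] vec_eq_iff fun_eq_iff
        using partial_eq_derivative[OF D] by (simp add: inner_axis)
      then show ?thesis unfolding v_def using \<open>C1c S (u e) _\<close> by simp
    qed
    have Hv: "H \<phi> x = - (\<Sum>e\<in>Basis. v e x \<bullet> e)" for x
      unfolding assms(14) div_form_op_def sum_Basis_axis v_def gradient_inner_axis u_def[abs_def] cO ..
    have div: "- (\<integral>x. X x \<bullet> h x \<partial>lborel) \<ge> k * (\<integral>x. \<zeta> x \<partial>lborel)"
      if "C1c S \<zeta> h" "\<And>x. \<zeta> x \<ge> 0" for \<zeta> h
      using divergence_ge_codimension_of_frontier[OF assms(4) that(1) S(2) that(2)] assms(6,7) \<Omega>
      by (simp add: k_def)
    have "(\<integral>x. \<bar>\<Sum>e\<in>Basis. v e x \<bullet> e\<bar> powr p \<partial>lborel) \<ge>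
      rellich_const k p \<delta> \<delta>' powr p * (\<integral>x. \<bar>weight \<delta> \<delta>' (r x) * \<phi> x / (r x)\<^sup>2\<bar> powr p \<partial>lborel)"
      by (rule rellich_inequality[OF \<phi> S(2) flux[unfolded u_def] div p del cond cp])
    moreover have "(LINT x:\<Omega>|lborel. \<bar>H \<phi> x\<bar> powr p) = (\<integral>x. \<bar>\<Sum>e\<in>Basis. v e x \<bullet> e\<bar> powr p \<partial>lborel)"
      unfolding set_lebesgue_integral_def
    proof (rule Bochner_Integration.integral_cong[OF refl])
      fix x
      show "indicator \<Omega> x *\<^sub>R \<bar>H \<phi> x\<bar> powr p = \<bar>\<Sum>e\<in>Basis. v e x \<bullet> e\<bar> powr p"
      proof (cases "x \<in> \<Omega>")
        case False
        then have "x \<notin> S" using S\<Omega> by auto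
        then show ?thesis using False C1c_gradient_eq_0[OF flux] by simp
      qed (simp add: Hv)
    qed
    moreover have "(LINT x:\<Omega>|lborel. \<bar>c\<^sub>\<Omega> x * \<phi> x / (d\<^sub>\<Gamma> x)\<^sup>2\<bar> powr p)
        = (\<integral>x. \<bar>weight \<delta> \<delta>' (r x) * \<phi> x / (r x)\<^sup>2\<bar> powr p \<partial>lborel)"
      unfolding set_lebesgue_integral_def cO dG
    proof (rule Bochner_Integration.integral_cong[OF refl])
      fix x
      have "x \<notin> \<Omega> \<Longrightarrow> \<phi> x = 0" using S\<Omega> \<phi>0 by auto
      then show "indicator \<Omega> x *\<^sub>R \<bar>weight \<delta> \<delta>' (r x) * \<phi> x / (r x)\<^sup>2\<bar> powr p
          = \<bar>weight \<delta> \<delta>' (r x) * \<phi> x / (r x)\<^sup>2\<bar> powr p"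
        by (cases "x \<in> \<Omega>") auto
    qed
    ultimately show ?thesis by (simp add: c_def)
  qed
  then show ?thesis
    using c0 cC cpos by (intro exI[of _ c]) (auto simp: ceq Ceq)
qed

end
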